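(* Let $c\in\mathcal{C}([-1,1];\mathbb{R})$ and let $m\in\mathcal{C}^1([-1,1];\mathbb{R})$ satisfy condition (Hm) (stated in the context), with $x_0\in(-1,1)$ the point given there. Suppose that $c$ satisfies one of the following conditions: (a) there exists $y_0\in(-1,1)$ such that $c$ is strictly increasing in $[-1,y_0)$ and strictly decreasing in $(y_0,1]$; (b) there exists $y_0\in(-1,1)$ such that $c$ is strictly decreasing in $[-1,y_0)$ and strictly increasing in $(y_0,1]$; (c) $c$ is strictly increasing in $[-1,1]$; (d) $c$ is strictly decreasing in $[-1,1]$. For each $s$, let $\lambda(s)$ be the principal eigenvalue of $$-\varphi''-2s\,m'(x)\varphi'+c(x)\varphi=\lambda\varphi \ \text{ in } [-1,1],\qquad \varphi'(-1)=\varphi'(1)=0 .$$ Then $$\lim_{s\uparrow\infty}\lambda(s)=c(x_0).$$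
   Context: Condition (Hm): $m\in\mathcal{C}^1([-1,1];\mathbb{R})$, and there is a unique $x_0\in(-1,1)$ such that $m(x_0)=\|m\|_\infty=\max_{|x|\le 1}m(x)$, where $\|\cdot\|_\infty$ is the supremum norm on $[-1,1]$. Moreover, $m'(x)\ge 0$ for all $x\in[-1,x_0)$, $m'(x)\le 0$ for all $x\in(x_0,1]$, and $m$ has at most finitely many critical points (zeros of $m'$) in $(-1,1)$. For each $s\in\mathbb{R}$, the principal eigenvalue $\lambda(s)$ of the Neumann problem $-\varphi''-2s\,m'(x)\varphi'+c(x)\varphi=\lambda\varphi$ in $[-1,1]$, $\varphi'(-1)=\varphi'(1)=0$, is the unique real number $\lambda$ for which this problem has a positive solution $\varphi\in\mathcal{C}^2([-1,1])$. *)

theory Defs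
  imports "HOL-Analysis.Analysis"
begin

text \<open>
  Continuous differentiability on a closed interval uses derivatives within the interval,
  i.e. one-sided derivatives at the end points; only the values on \<open>S\<close> matter.
\<close>

definition C1_on :: "real set \<Rightarrow> (real \<Rightarrow> real) \<Rightarrow> (real \<Rightarrow> real) \<Rightarrow> bool" where
  "C1_on S f f' \<longleftrightarrow>
     (\<forall>x\<in>S. (f has_real_derivative f' x) (at x within S)) \<and> continuous_on S f'"

definition is_max_point :: "(real \<Rightarrow> real) \<Rightarrow> real \<Rightarrow> bool" where
  "is_max_point m x \<longleftrightarrow>
     m x = (SUP y\<in>{-1..1}. \<bar>m y\<bar>) \<and> m x = (SUP y\<in>{-1..1}. m y)"

definition cond_Hm :: "(real \<Rightarrow> real) \<Rightarrow> (real \<Rightarrow> real) \<Rightarrow> real \<Rightarrow> bool" where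
  "cond_Hm m m' x0 \<longleftrightarrow>
     C1_on {-1..1} m m' \<and>
     x0 \<in> {-1<..<1} \<and> is_max_point m x0 \<and>
     (\<forall>y\<in>{-1<..<1}. is_max_point m y \<longrightarrow> y = x0) \<and>
     (\<forall>x\<in>{-1..<x0}. m' x \<ge> 0) \<and>
     (\<forall>x\<in>{x0<..1}. m' x \<le> 0) \<and>
     finite {x \<in> {-1<..<1}. m' x = 0}"

definition has_positive_neumann_solution ::
  "(real \<Rightarrow> real) \<Rightarrow> (real \<Rightarrow> real) \<Rightarrow> real \<Rightarrow> real \<Rightarrow> bool" where
  "has_positive_neumann_solution m' c s l \<longleftrightarrow>
     (\<exists>\<phi> \<phi>' \<phi>''.
        C1_on {-1..1} \<phi> \<phi>' \<and> C1_on {-1..1} \<phi>' \<phi>'' \<and>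
        (\<forall>x\<in>{-1..1}. \<phi> x > 0) \<and>
        (\<forall>x\<in>{-1..1}. - \<phi>'' x - 2 * s * m' x * \<phi>' x + c x * \<phi> x = l * \<phi> x) \<and>
        \<phi>' (-1) = 0 \<and> \<phi>' 1 = 0)"

definition principal_eigenvalue ::
  "(real \<Rightarrow> real) \<Rightarrow> (real \<Rightarrow> real) \<Rightarrow> real \<Rightarrow> real" where
  "principal_eigenvalue m' c s = (THE l. has_positive_neumann_solution m' c s l)"

end

theory Submission
  imports Defs
begin

text \<open>
  With \<open>p = exp (2 s m)\<close> the eigenvalue equation reads \<open>(p \<phi>')' = p (c - \<lambda>) \<phi>\<close>, and with
  \<open>v = \<phi>'/\<phi>\<close> it is the Riccati equation \<open>v' + v\<^sup>2 + 2 s m' v = c - \<lambda>\<close>, where \<open>v\<close> vanishes at both ends.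
  The limit follows from two bounds on any eigenvalue with a positive eigenfunction.
  
  Upper bound. Integrating \<open>(p v)' = p (c - \<lambda>) - p v\<^sup>2\<close> gives \<open>0 \<le> \<integral> p (c - \<lambda>)\<close>
  (\<open>eigenvalue_integral_inequality\<close>). As \<open>s\<close> grows, the weight \<open>p\<close> concentrates at the strict
  maximum \<open>x0\<close> of \<open>m\<close> (\<open>laplace_concentration\<close>), so \<open>\<lambda>\<close> cannot exceed \<open>c x0\<close> by a fixed amount.
  
  Lower bound. To the left of \<open>x0\<close> a barrier \<open>w \<le> 0\<close> is built, independent of \<open>s\<close>, with \<open>w x0 = 0\<close>
  and \<open>w' + w\<^sup>2 + 2 s m' w \<le> c - (c x0 - \<epsilon>)\<close> for all large \<open>s\<close> (\<open>barrier_exists\<close>). Near \<open>x0\<close> the barrier only has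
  to be small together with its derivative; away from \<open>x0\<close> the drift term
  \<open>2 s m' w\<close> is very negative, except near the finitely many zeros of \<open>m'\<close>, where \<open>w\<close> is instead
  made to decrease steeply over a short distance. If \<open>\<lambda> < c x0 - \<epsilon>\<close>, comparing \<open>v\<close> with \<open>w\<close> gives
  \<open>\<phi>' x0 > 0\<close> (\<open>barrier_comparison\<close>). The reflected argument on the right of \<open>x0\<close> gives
  \<open>\<phi>' x0 < 0\<close>, a contradiction.
  
  Both bounds concern the principal eigenvalue only once it is known to exist and to be unique.
  Uniqueness is the monotonicity of a Wronskian. Existence is by shooting: the first-order system for
  \<open>(\<phi>, p \<phi>')\<close> with initial values \<open>(1, 0)\<close> is solved for every \<open>\<lambda>\<close>, the solution depends continuously on \<open>\<lambda>\<close>,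
  and the connectedness of the real line provides a \<open>\<lambda>\<close> at which \<open>\<phi>\<close> is still positive and
  \<open>\<phi>'\<close> vanishes at the right end (\<open>positive_neumann_shooting_exists\<close>).
\<close>

section \<open>Monotonicity from one-sided derivatives\<close>

lemma nondecreasing_if_derivative_nonneg:
  fixes F F' :: "real \<Rightarrow> real"
  assumes d: "\<And>x. x \<in> {a..b} \<Longrightarrow> (F has_real_derivative F' x) (at x within {a..b})"
    and nn: "\<And>x. x \<in> {a..b} \<Longrightarrow> 0 \<le> F' x"
    and xy: "a \<le> x" "x \<le> y" "y \<le> b"
  shows "F x \<le> F y"
proof (rule DERIV_nonneg_imp_increasing_open[OF \<open>x \<le> y\<close>])
  show "\<exists>D. DERIV F t :> D \<and> D \<ge> 0" if "x < t" "t < y" for t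
    using d[of t] nn[of t] that xy by (auto simp: at_within_Icc_at)
  have "continuous_on {a..b} F"
    using d by (rule DERIV_continuous_on)
  then show "continuous_on {x..y} F"
    using xy by (auto intro: continuous_on_subset)
qed

lemma increasing_if_derivative_pos:
  fixes F F' :: "real \<Rightarrow> real"
  assumes d: "\<And>x. x \<in> {a..b} \<Longrightarrow> (F has_real_derivative F' x) (at x within {a..b})"
    and pos: "\<And>x. x \<in> {a..b} \<Longrightarrow> 0 < F' x"
    and xy: "a \<le> x" "x < y" "y \<le> b"
  shows "F x < F y"
proof (rule DERIV_pos_imp_increasing_open[OF \<open>x < y\<close>])
  show "\<exists>D. DERIV F t :> D \<and> D > 0" if "x < t" "t < y" for t
    using d[of t] pos[of t] that xy by (auto simp: at_within_Icc_at)
  have "continuous_on {a..b} F"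
    using d by (rule DERIV_continuous_on)
  then show "continuous_on {x..y} F"
    using xy by (auto intro: continuous_on_subset)
qed

lemma abs_le_if_abs_derivative_le:
  fixes F F' G G' :: "real \<Rightarrow> real"
  assumes dF: "\<And>x. x \<in> {a..b} \<Longrightarrow> (F has_real_derivative F' x) (at x within {a..b})"
    and dG: "\<And>x. x \<in> {a..b} \<Longrightarrow> (G has_real_derivative G' x) (at x within {a..b})"
    and le: "\<And>x. x \<in> {a..b} \<Longrightarrow> \<bar>F' x\<bar> \<le> G' x"
    and init: "\<bar>F a\<bar> \<le> G a" and x: "x \<in> {a..b}"
  shows "\<bar>F x\<bar> \<le> G x"
proof -
  have le': "F' t \<le> G' t" "0 \<le> G' t + F' t" if "t \<in> {a..b}" for t
    using le[OF that] by linarith+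
  have "G a - F a \<le> G x - F x"
    by (rule nondecreasing_if_derivative_nonneg[of a b "\<lambda>x. G x - F x" "\<lambda>x. G' x - F' x" a x])
       (use x le' in \<open>auto intro!: DERIV_diff dF dG\<close>)
  moreover have "G a + F a \<le> G x + F x"
    by (rule nondecreasing_if_derivative_nonneg[of a b "\<lambda>x. G x + F x" "\<lambda>x. G' x + F' x" a x])
       (use x le' in \<open>auto intro!: DERIV_add dF dG\<close>)
  ultimately show ?thesis using init by linarith
qed

text \<open>
  The weight \<open>exp (- k (x - a))\<close> turns the differential inequality into one for a derivative alone.
\<close>

lemma gronwall:
  fixes E E' :: "real \<Rightarrow> real"
  assumes d: "\<And>x. x \<in> {a..b} \<Longrightarrow> (E has_real_derivative E' x) (at x within {a..b})"
    and le: "\<And>x. x \<in> {a..b} \<Longrightarrow> E' x \<le> k * E x + h"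
    and nn: "0 \<le> k" "0 \<le> h" and init: "E a \<le> 0" and x: "x \<in> {a..b}"
  shows "E x \<le> h * (b - a) * exp (k * (b - a))"
proof -
  let ?F = "\<lambda>x. h * x - exp (- (k * (x - a))) * E x"
  have "?F a \<le> ?F x"
  proof (rule nondecreasing_if_derivative_nonneg[of a b ?F
        "\<lambda>t. h - exp (- (k * (t - a))) * (E' t - k * E t)" a x])
    fix t assume t: "t \<in> {a..b}"
    show "(?F has_real_derivative h - exp (- (k * (t - a))) * (E' t - k * E t)) (at t within {a..b})"
      by (auto intro!: derivative_eq_intros d t simp: algebra_simps)
    have "exp (- (k * (t - a))) * (E' t - k * E t) \<le> exp (- (k * (t - a))) * h"
      using le[OF t] by (intro mult_left_mono) auto
    also have "\<dots> \<le> 1 * h"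
      using t nn by (intro mult_right_mono) auto
    finally show "0 \<le> h - exp (- (k * (t - a))) * (E' t - k * E t)" by simp
  qed (use x in auto)
  then have "exp (- (k * (x - a))) * E x \<le> h * (x - a)"
    using init by (simp add: algebra_simps)
  also have "\<dots> \<le> h * (b - a)"
    using x nn by (intro mult_left_mono) auto
  finally have *: "exp (- (k * (x - a))) * E x \<le> h * (b - a)" .
  have "E x = exp (k * (x - a)) * (exp (- (k * (x - a))) * E x)"
    by (simp flip: exp_add mult.assoc)
  also have "\<dots> \<le> exp (k * (x - a)) * (h * (b - a))"
    using * by (intro mult_left_mono) auto
  also have "\<dots> \<le> exp (k * (b - a)) * (h * (b - a))"
    using x nn by (intro mult_right_mono) (auto intro!: mult_left_mono)
  finally show ?thesis by (simp add: mult_ac)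
qed

lemma continuous_on_Icc_bounded:
  fixes f :: "real \<Rightarrow> real"
  assumes "continuous_on {a..b} f"
  obtains K where "0 < K" "\<And>x. x \<in> {a..b} \<Longrightarrow> \<bar>f x\<bar> \<le> K"
proof -
  have "bounded (f ` {a..b})"
    using assms by (intro compact_imp_bounded compact_continuous_image) auto
  then show ?thesis
    unfolding bounded_pos using that by (auto simp: image_iff)
qed

section \<open>Linear planar systems\<close>

text \<open>
  The increments of the Picard iteration for \<open>u' = f v\<close>, \<open>v' = g u\<close> started at \<open>(1, 0)\<close>; their sum is
  the solution.
\<close>

primrec picard_term ::
  "(real \<Rightarrow> real) \<Rightarrow> (real \<Rightarrow> real) \<Rightarrow> real \<Rightarrow> nat \<Rightarrow> (real \<Rightarrow> real) \<times> (real \<Rightarrow> real)" where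
  "picard_term f g a 0 = (\<lambda>x. 1, \<lambda>x. 0)"
| "picard_term f g a (Suc n) =
     (\<lambda>x. integral {a..x} (\<lambda>t. f t * snd (picard_term f g a n) t),
      \<lambda>x. integral {a..x} (\<lambda>t. g t * fst (picard_term f g a n) t))"

text \<open>
  The \<open>n\<close>-th Picard increment is at most \<open>(L (x - a))\<^sup>n / n!\<close> when \<open>L\<close> bounds \<open>f\<close> and \<open>g\<close>, so the series
  and the series of derivatives converge uniformly and may be differentiated termwise.
\<close>

lemma planar_system_exists:
  fixes f g :: "real \<Rightarrow> real"
  assumes ab: "a \<le> b" and cf: "continuous_on {a..b} f" and cg: "continuous_on {a..b} g"
  shows "\<exists>u v. u a = 1 \<and> v a = 0 \<and>
     (\<forall>x\<in>{a..b}. (u has_real_derivative f x * v x) (at x within {a..b})) \<and>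
     (\<forall>x\<in>{a..b}. (v has_real_derivative g x * u x) (at x within {a..b}))"
proof -
  obtain Kf where Kf: "0 < Kf" "\<And>x. x \<in> {a..b} \<Longrightarrow> \<bar>f x\<bar> \<le> Kf"
    using continuous_on_Icc_bounded[OF cf] by blast
  obtain Kg where Kg: "0 < Kg" "\<And>x. x \<in> {a..b} \<Longrightarrow> \<bar>g x\<bar> \<le> Kg"
    using continuous_on_Icc_bounded[OF cg] by blast
  define L where "L = max Kf Kg"
  have L: "0 < L" "\<And>x. x \<in> {a..b} \<Longrightarrow> \<bar>f x\<bar> \<le> L" "\<And>x. x \<in> {a..b} \<Longrightarrow> \<bar>g x\<bar> \<le> L"
    unfolding L_def using Kf Kg by (auto simp: le_max_iff_disj)
  define u where "u n = fst (picard_term f g a n)" for n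
  define v where "v n = snd (picard_term f g a n)" for n
  define u' where "u' n x = (case n of 0 \<Rightarrow> 0 | Suc k \<Rightarrow> f x * v k x)" for n x
  define v' where "v' n x = (case n of 0 \<Rightarrow> 0 | Suc k \<Rightarrow> g x * u k x)" for n x
  have u_Suc: "u (Suc n) = (\<lambda>x. integral {a..x} (\<lambda>t. f t * v n t))" 
   and v_Suc: "v (Suc n) = (\<lambda>x. integral {a..x} (\<lambda>t. g t * u n t))" for n
    by (simp_all add: u_def v_def)
  have u0: "u 0 = (\<lambda>x. 1)" and v0: "v 0 = (\<lambda>x. 0)" by (simp_all add: u_def v_def)
  have cont: "continuous_on {a..b} (u n) \<and> continuous_on {a..b} (v n)" for n
  proof (induction n)
    case (Suc n)
    then show ?case unfolding u_Suc v_Suc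
      by (intro conjI indefinite_integral_continuous_1 integrable_continuous_real
            continuous_on_mult cf cg) auto
  qed (simp add: u0 v0)
  have du: "(u n has_real_derivative u' n x) (at x within {a..b})" 
   and dv: "(v n has_real_derivative v' n x) (at x within {a..b})" if "x \<in> {a..b}" for n x
    using cont that
    by (cases n; auto simp: u0 v0 u_Suc v_Suc u'_def v'_def
          intro!: integral_has_real_derivative continuous_on_mult cf cg)+
  define B where "B n x = (L * (x - a)) ^ n / fact n" for n x
  have dB: "(B (Suc n) has_real_derivative L * B n x) (at x within {a..b})" for n x
  proof -
    have "((\<lambda>x. L * (x - a)) has_real_derivative L) (at x within {a..b})"
      by (auto intro!: derivative_eq_intros)
    then have "((\<lambda>x. (L * (x - a)) ^ Suc n / fact (Suc n)) has_real_derivative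
        real (Suc n) * (L * (L * (x - a)) ^ (Suc n - Suc 0)) / fact (Suc n)) (at x within {a..b})"
      by (intro DERIV_cdivide DERIV_power)
    moreover have "real (Suc n) * (L * (L * (x - a)) ^ (Suc n - Suc 0)) / fact (Suc n) = L * B n x"
      by (simp add: B_def del: of_nat_Suc)
    ultimately show ?thesis unfolding B_def by simp
  qed
  have bnd: "\<bar>u n x\<bar> \<le> B n x \<and> \<bar>v n x\<bar> \<le> B n x" if "x \<in> {a..b}" for n x
    using that
  proof (induction n arbitrary: x)
    case 0
    then show ?case by (simp add: u0 v0 B_def)
  next
    case (Suc n)
    have "\<bar>u' (Suc n) t\<bar> \<le> L * B n t" "\<bar>v' (Suc n) t\<bar> \<le> L * B n t" if "t \<in> {a..b}" for t
      using Suc.IH[OF that] L(1) L(2,3)[OF that]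
      by (auto simp: u'_def v'_def abs_mult intro!: mult_mono)
    moreover have "u (Suc n) a = 0" "v (Suc n) a = 0" "B (Suc n) a = 0"
      by (auto simp: u_Suc v_Suc B_def)
    ultimately show ?case
      using abs_le_if_abs_derivative_le[of a b "u (Suc n)" "u' (Suc n)" "B (Suc n)" "\<lambda>t. L * B n t" x]
        abs_le_if_abs_derivative_le[of a b "v (Suc n)" "v' (Suc n)" "B (Suc n)" "\<lambda>t. L * B n t" x]
        du dv dB Suc.prems by simp
  qed
  define M where "M n = (L * (b - a)) ^ n / fact n" for n
  have summM: "summable M"
    unfolding M_def using summable_exp[of "L * (b - a)"] by (simp add: field_simps)
  have BM: "B n x \<le> M n" if "x \<in> {a..b}" for n x
    using that L(1) ab by (auto simp: B_def M_def intro!: divide_right_mono power_mono mult_left_mono)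
  have uM: "\<bar>u n x\<bar> \<le> M n" and vM: "\<bar>v n x\<bar> \<le> M n" if "x \<in> {a..b}" for n x
    using bnd[OF that, of n] BM[OF that, of n] by auto
  define N where "N n = (case n of 0 \<Rightarrow> 0 | Suc k \<Rightarrow> L * M k)" for n
  have summN: "summable N"
    using summM by (subst summable_Suc_iff[symmetric]) (simp add: N_def summable_mult)
  have u'N: "norm (u' n x) \<le> N n" and v'N: "norm (v' n x) \<le> N n" if "x \<in> {a..b}" for n x
    using uM[OF that] vM[OF that] L(1) L(2,3)[OF that]
    by (auto simp: u'_def v'_def N_def abs_mult split: nat.split intro!: mult_mono)
  have a: "a \<in> {a..b}" using ab by auto
  have summ: "summable (\<lambda>n. u n x)" "summable (\<lambda>n. v n x)" if "x \<in> {a..b}" for x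
    using uM[OF that] vM[OF that] summM by (auto intro!: summable_comparison_test'[of M 0])
  obtain U where U: "\<forall>x\<in>{a..b}. (\<lambda>n. u n x) sums U x \<and>
      (U has_real_derivative (\<Sum>n. u' n x)) (at x within {a..b})"
    using has_field_derivative_series[OF convex_closed_interval du 
       Weierstrass_m_test[OF u'N summN] a summ(1)[OF a]] by blast
  obtain V where V: "\<forall>x\<in>{a..b}. (\<lambda>n. v n x) sums V x \<and>
      (V has_real_derivative (\<Sum>n. v' n x)) (at x within {a..b})"
    using has_field_derivative_series[OF convex_closed_interval dv 
       Weierstrass_m_test[OF v'N summN] a summ(2)[OF a]] by blast
  have u's: "(\<Sum>n. u' n x) = f x * V x" if "x \<in> {a..b}" for x
  proof -
    have "(\<lambda>n. u' (Suc n) x) sums (f x * V x)"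
      using V that by (simp add: u'_def sums_mult)
    then have "(\<lambda>n. u' n x) sums (f x * V x + u' 0 x)" by (rule sums_Suc)
    then show ?thesis by (simp add: sums_iff u'_def)
  qed
  have v's: "(\<Sum>n. v' n x) = g x * U x" if "x \<in> {a..b}" for x
  proof -
    have "(\<lambda>n. v' (Suc n) x) sums (g x * U x)"
      using U that by (simp add: v'_def sums_mult)
    then have "(\<lambda>n. v' n x) sums (g x * U x + v' 0 x)" by (rule sums_Suc)
    then show ?thesis by (simp add: sums_iff v'_def)
  qed
  have "(\<lambda>n. u (Suc n) a) sums 0" "(\<lambda>n. v (Suc n) a) sums 0"
    by (simp_all add: u_Suc v_Suc)
  then have "(\<lambda>n. u n a) sums (0 + u 0 a)" "(\<lambda>n. v n a) sums (0 + v 0 a)"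
    by (blast intro: sums_Suc)+
  then have "U a = 1" "V a = 0"
    using U V a by (auto simp: u0 v0 dest: sums_unique2)
  then show ?thesis using U V u's v's by auto
qed

lemma cross_term_le:
  fixes x y :: real
  assumes "\<bar>k\<bar> \<le> L"
  shows "\<bar>2 * x * (k * y)\<bar> \<le> L * (x\<^sup>2 + y\<^sup>2)"
proof -
  have "2 * \<bar>x\<bar> * \<bar>y\<bar> \<le> x\<^sup>2 + y\<^sup>2"
    using sum_squares_bound[of "\<bar>x\<bar>" "\<bar>y\<bar>"] by simp
  then have "\<bar>k\<bar> * (2 * \<bar>x\<bar> * \<bar>y\<bar>) \<le> L * (x\<^sup>2 + y\<^sup>2)"
    using assms by (intro mult_mono) auto
  then show ?thesis by (simp add: abs_mult mult_ac)
qed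

text \<open>
  Backward uniqueness: for large \<open>k\<close>, \<open>exp (k t) (u\<^sup>2 + v\<^sup>2)\<close> is nondecreasing, so a zero of the pair at \<open>x\<close>
  forces a zero at \<open>a\<close>.
\<close>

lemma planar_system_vanishing_backward:
  fixes f g u v :: "real \<Rightarrow> real"
  assumes cf: "continuous_on {a..b} f" and cg: "continuous_on {a..b} g"
    and du: "\<And>t. t \<in> {a..b} \<Longrightarrow> (u has_real_derivative f t * v t) (at t within {a..b})"
    and dv: "\<And>t. t \<in> {a..b} \<Longrightarrow> (v has_real_derivative g t * u t) (at t within {a..b})"
    and x: "x \<in> {a..b}" "u x = 0" "v x = 0"
  shows "u a = 0"
proof -
  obtain Kf where Kf: "0 < Kf" "\<And>x. x \<in> {a..b} \<Longrightarrow> \<bar>f x\<bar> \<le> Kf"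
    using continuous_on_Icc_bounded[OF cf] by blast
  obtain Kg where Kg: "0 < Kg" "\<And>x. x \<in> {a..b} \<Longrightarrow> \<bar>g x\<bar> \<le> Kg"
    using continuous_on_Icc_bounded[OF cg] by blast
  define k where "k = Kf + Kg"
  let ?E = "\<lambda>t. (u t)\<^sup>2 + (v t)\<^sup>2"
  let ?E' = "\<lambda>t. 2 * u t * (f t * v t) + 2 * v t * (g t * u t)"
  have "exp (k * a) * ?E a \<le> exp (k * x) * ?E x"
  proof (rule nondecreasing_if_derivative_nonneg[of a b "\<lambda>t. exp (k * t) * ?E t"
          "\<lambda>t. exp (k * t) * (k * ?E t + ?E' t)" a x])
    fix t assume t: "t \<in> {a..b}"
    show "((\<lambda>t. exp (k * t) * ?E t) has_real_derivative exp (k * t) * (k * ?E t + ?E' t))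
        (at t within {a..b})"
      by (auto intro!: derivative_eq_intros du dv t simp: algebra_simps)
    have "0 \<le> k * ?E t + ?E' t"
      using cross_term_le[OF Kf(2)[OF t], of "u t" "v t"] cross_term_le[OF Kg(2)[OF t], of "v t" "u t"]
      by (simp add: k_def algebra_simps abs_le_iff)
    then show "0 \<le> exp (k * t) * (k * ?E t + ?E' t)" by simp
  qed (use x in auto)
  then have "?E a \<le> 0"
    using x by (simp add: mult_le_0_iff)
  then show ?thesis by (simp add: sum_power2_le_zero_iff)
qed

section \<open>Existence and uniqueness of the principal eigenvalue\<close>

text \<open>
  The difference of the solutions for \<open>l\<close> and \<open>l0\<close> solves the system for \<open>l\<close> with the source term
  \<open>p (l0 - l) U l0\<close>, so Gronwall's inequality for its squared length bounds it by a multiple of \<open>\<bar>l - l0\<bar>\<close>.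
\<close>

lemma shooting_continuous_in_parameter:
  fixes p c :: "real \<Rightarrow> real" and U V :: "real \<Rightarrow> real \<Rightarrow> real"
  assumes ab: "a < b"
    and cp: "continuous_on {a..b} p" and p: "\<And>x. x \<in> {a..b} \<Longrightarrow> 0 < p x"
    and cc: "continuous_on {a..b} c"
    and init: "\<And>l. U l a = 1" "\<And>l. V l a = 0"
    and dU: "\<And>l x. x \<in> {a..b} \<Longrightarrow> (U l has_real_derivative 1 / p x * V l x) (at x within {a..b})"
    and dV: "\<And>l x. x \<in> {a..b} \<Longrightarrow>
      (V l has_real_derivative p x * (c x - l) * U l x) (at x within {a..b})"
    and e: "0 < e"
  shows "\<exists>d>0. \<forall>l. \<bar>l - l0\<bar> < d \<longrightarrow>
    (\<forall>x\<in>{a..b}. \<bar>U l x - U l0 x\<bar> < e \<and> \<bar>V l x - V l0 x\<bar> < e)"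
proof -
  have "continuous_on {a..b} (\<lambda>x. 1 / p x)"
    using p by (intro continuous_intros cp) force
  then obtain L where L: "0 < L" "\<And>x. x \<in> {a..b} \<Longrightarrow> \<bar>1 / p x\<bar> \<le> L"
    using continuous_on_Icc_bounded by blast
  obtain P where P: "0 < P" "\<And>x. x \<in> {a..b} \<Longrightarrow> \<bar>p x\<bar> \<le> P"
    using continuous_on_Icc_bounded[OF cp] by blast
  obtain C where C: "0 < C" "\<And>x. x \<in> {a..b} \<Longrightarrow> \<bar>c x\<bar> \<le> C"
    using continuous_on_Icc_bounded[OF cc] by blast
  have "continuous_on {a..b} (U l0)"
    using dU by (rule DERIV_continuous_on)
  then obtain K where K: "0 < K" "\<And>x. x \<in> {a..b} \<Longrightarrow> \<bar>U l0 x\<bar> \<le> K"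
    using continuous_on_Icc_bounded by blast
  define G where "G = P * (C + \<bar>l0\<bar> + 1)"
  define k where "k = L + G + 1"
  define D where "D = (P * K)\<^sup>2 * (b - a) * exp (k * (b - a))"
  have k0: "0 \<le> k" using L P C by (simp add: k_def G_def)
  have D0: "0 < D" using P K ab by (simp add: D_def)
  have close: "(U l x - U l0 x)\<^sup>2 + (V l x - V l0 x)\<^sup>2 \<le> D * (l - l0)\<^sup>2"
    if l: "\<bar>l - l0\<bar> \<le> 1" and x: "x \<in> {a..b}" for l x
  proof -
    let ?u = "\<lambda>x. U l x - U l0 x" and ?v = "\<lambda>x. V l x - V l0 x"
    let ?E = "\<lambda>x. (?u x)\<^sup>2 + (?v x)\<^sup>2"
    let ?h = "\<lambda>x. p x * (l0 - l) * U l0 x"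
    let ?E' = "\<lambda>x. 2 * ?u x * (1 / p x * ?v x) + 2 * ?v x * (p x * (c x - l) * ?u x) + 2 * ?v x * ?h x"
    have "?E x \<le> (P * K * (l - l0))\<^sup>2 * (b - a) * exp (k * (b - a))"
    proof (rule gronwall[of a b ?E ?E'])
      fix t assume t: "t \<in> {a..b}"
      show "(?E has_real_derivative ?E' t) (at t within {a..b})"
        by (rule derivative_eq_intros dU dV t refl)+ (simp add: algebra_simps)
      have "\<bar>p t * (c t - l)\<bar> \<le> G"
        unfolding G_def abs_mult using P(1) P(2)[OF t] C(1) C(2)[OF t] l by (intro mult_mono) auto
      then have 1: "2 * ?v t * (p t * (c t - l) * ?u t) \<le> G * ?E t"
        using cross_term_le[of "p t * (c t - l)" G "?v t" "?u t"] by (simp add: add.commute)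
      have 2: "2 * ?u t * (1 / p t * ?v t) \<le> L * ?E t"
        by (rule order_trans[OF abs_ge_self cross_term_le[OF L(2)[OF t]]])
      have "\<bar>?h t\<bar> \<le> \<bar>P * K * (l - l0)\<bar>"
      proof -
        have "\<bar>p t\<bar> * \<bar>U l0 t\<bar> \<le> P * K"
          using P(1) P(2)[OF t] K(2)[OF t] by (intro mult_mono) auto
        then have "\<bar>p t\<bar> * \<bar>U l0 t\<bar> * \<bar>l - l0\<bar> \<le> P * K * \<bar>l - l0\<bar>"
          by (rule mult_right_mono) simp
        then show ?thesis
          using P(1) K(1) by (simp add: abs_mult abs_minus_commute mult_ac)
      qed
      then have "(?h t)\<^sup>2 \<le> (P * K * (l - l0))\<^sup>2" by (simp add: abs_le_square_iff)
      moreover have "2 * ?v t * ?h t \<le> (?v t)\<^sup>2 + (?h t)\<^sup>2" by (rule sum_squares_bound)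
      ultimately have 3: "2 * ?v t * ?h t \<le> ?E t + (P * K * (l - l0))\<^sup>2"
        using zero_le_power2[of "?u t"] by linarith
      show "?E' t \<le> k * ?E t + (P * K * (l - l0))\<^sup>2"
        using add_mono[OF add_mono[OF 2 1] 3] by (simp only: k_def distrib_right mult_1_left add.assoc)
    qed (use x init k0 in auto)
    then show ?thesis by (simp add: D_def power_mult_distrib mult_ac)
  qed
  define d where "d = min 1 (e / (2 * sqrt D))"
  have "\<bar>U l x - U l0 x\<bar> < e \<and> \<bar>V l x - V l0 x\<bar> < e" if l: "\<bar>l - l0\<bar> < d" and x: "x \<in> {a..b}" for l x
  proof -
    have "sqrt D * \<bar>l - l0\<bar> < e"
    proof -
      have "sqrt D * \<bar>l - l0\<bar> \<le> sqrt D * (e / (2 * sqrt D))"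
        using l D0 by (intro mult_left_mono) (auto simp: d_def)
      also have "\<dots> = e / 2" using D0 by (simp add: field_simps)
      finally show ?thesis using e by simp
    qed
    moreover have "D * (l - l0)\<^sup>2 = (sqrt D * \<bar>l - l0\<bar>)\<^sup>2"
      using D0 by (simp add: power_mult_distrib)
    ultimately have "D * (l - l0)\<^sup>2 < e\<^sup>2"
      using D0 by (simp add: power_strict_mono)
    then have "(U l x - U l0 x)\<^sup>2 + (V l x - V l0 x)\<^sup>2 < e\<^sup>2"
      using close[OF _ x, of l] l by (simp add: d_def)
    then have "(U l x - U l0 x)\<^sup>2 < e\<^sup>2" "(V l x - V l0 x)\<^sup>2 < e\<^sup>2"
      using zero_le_power2[of "U l x - U l0 x"] zero_le_power2[of "V l x - V l0 x"] by linarith+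
    then show ?thesis
      using e by (auto simp: abs_square_less_1 intro: power2_less_imp_less[of "\<bar>_\<bar>"])
  qed
  moreover have "0 < d" using e D0 by (simp add: d_def)
  ultimately show ?thesis by blast
qed

text \<open>
  Let \<open>A\<close> be the set of parameters for which the solution stays positive with positive final slope, and
  \<open>B\<close> the set of those for which the solution is negative somewhere or has negative final slope. Both are
  open, they are disjoint, \<open>A\<close> contains very negative parameters and \<open>B\<close> large ones.
  Since the real line is connected, some parameter belongs to neither. Its solution is nonnegative, hence
  positive because a zero would be a double zero, and then its final slope must vanish.
\<close>

lemma positive_neumann_shooting_exists:
  fixes p c :: "real \<Rightarrow> real"
  assumes ab: "a < b"
    and cp: "continuous_on {a..b} p" and p: "\<And>x. x \<in> {a..b} \<Longrightarrow> 0 < p x"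
    and cc: "continuous_on {a..b} c"
  shows "\<exists>l u v. (\<forall>x\<in>{a..b}. (u has_real_derivative 1 / p x * v x) (at x within {a..b})) \<and>
     (\<forall>x\<in>{a..b}. (v has_real_derivative p x * (c x - l) * u x) (at x within {a..b})) \<and>
     (\<forall>x\<in>{a..b}. 0 < u x) \<and> v a = 0 \<and> v b = 0"
proof -
  have cf: "continuous_on {a..b} (\<lambda>x. 1 / p x)"
    using p by (intro continuous_intros cp) force
  have cg: "continuous_on {a..b} (\<lambda>x. p x * (c x - l))" for l
    by (intro continuous_intros cp cc)
  have "\<forall>l. \<exists>u v. u a = 1 \<and> v a = 0 \<and>
     (\<forall>x\<in>{a..b}. (u has_real_derivative 1 / p x * v x) (at x within {a..b})) \<and>
     (\<forall>x\<in>{a..b}. (v has_real_derivative p x * (c x - l) * u x) (at x within {a..b}))"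
    using planar_system_exists[OF less_imp_le[OF ab] cf cg] by blast
  then obtain U V where init: "\<And>l. U l a = 1" "\<And>l. V l a = 0"
    and dU: "\<And>l x. x \<in> {a..b} \<Longrightarrow> (U l has_real_derivative 1 / p x * V l x) (at x within {a..b})"
    and dV: "\<And>l x. x \<in> {a..b} \<Longrightarrow>
      (V l has_real_derivative p x * (c x - l) * U l x) (at x within {a..b})"
    by metis
  have near: "\<exists>d>0. \<forall>l. \<bar>l - l0\<bar> < d \<longrightarrow>
      (\<forall>x\<in>{a..b}. \<bar>U l x - U l0 x\<bar> < e \<and> \<bar>V l x - V l0 x\<bar> < e)" if "0 < e" for l0 e
    by (rule shooting_continuous_in_parameter[OF ab cp p cc init dU dV that])
  have cU: "continuous_on {a..b} (U l)" for l
    using dU by (rule DERIV_continuous_on)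
  have nondeg: False if "x \<in> {a..b}" "U l x = 0" "V l x = 0" for l x
    using planar_system_vanishing_backward[OF cf cg dU dV that] init by simp
  have pos: "0 < U l x" if nn: "\<And>x. x \<in> {a..b} \<Longrightarrow> 0 \<le> U l x" and Vb: "0 \<le> V l b" and x: "x \<in> {a..b}"
    for l x
  proof (rule ccontr)
    assume "\<not> 0 < U l x"
    then have Ux: "U l x = 0" using nn[OF x] by simp
    have xa: "x \<noteq> a" using Ux init(1)[of l] by auto
    \<comment> \<open>A zero is a minimum; at \<open>b\<close> this leaves the sign \<open>V l b \<le> 0\<close>, which \<open>Vb\<close> completes.\<close>
    have "V l x = 0"
    proof (cases "x = b")
      case True
      have "\<not> 0 < 1 / p b * V l b"
      proof
        assume *: "0 < 1 / p b * V l b"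
        have "b \<in> {a..b}" using ab by simp
        from has_real_derivative_pos_inc_left[OF dU[OF this] *]
        obtain d where d: "0 < d" "\<And>h. 0 < h \<Longrightarrow> b - h \<in> {a..b} \<Longrightarrow> h < d \<Longrightarrow> U l (b - h) < U l b"
          by blast
        define h where "h = min (d / 2) (b - a)"
        have "0 < h" "b - h \<in> {a..b}" "h < d" using d(1) ab by (auto simp: h_def min_def)
        with d(2)[of h] nn[of "b - h"] Ux True show False by simp
      qed
      then show ?thesis using Vb True p[of b] ab by (simp add: zero_less_divide_iff)
    next
      case False
      then have x': "a < x" "x < b" using x xa by auto
      then have "DERIV (U l) x :> 1 / p x * V l x"
        using dU[OF x, of l] by (simp add: at_within_Icc_at)
      then have "1 / p x * V l x = 0"
      proof (rule DERIV_local_min)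
        show "0 < min (x - a) (b - x)" using x' by simp
        show "\<forall>y. \<bar>x - y\<bar> < min (x - a) (b - x) \<longrightarrow> U l x \<le> U l y"
        proof (intro allI impI)
          fix y assume "\<bar>x - y\<bar> < min (x - a) (b - x)"
          then have "y \<in> {a..b}" by (auto simp: abs_less_iff)
          then show "U l x \<le> U l y" using nn Ux by simp
        qed
      qed
      then show ?thesis using p[OF x] by simp
    qed
    then show False using nondeg[OF x Ux] by simp
  qed
  obtain C where C: "0 < C" "\<And>x. x \<in> {a..b} \<Longrightarrow> \<bar>c x\<bar> \<le> C"
    using continuous_on_Icc_bounded[OF cc] by blast
  define A where "A = {l. (\<forall>x\<in>{a..b}. 0 < U l x) \<and> 0 < V l b}"
  define B where "B = {l. V l b < 0 \<or> (\<exists>x\<in>{a..b}. U l x < 0)}"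
  have b: "b \<in> {a..b}" using ab by simp
  have "open A"
    unfolding open_dist
  proof
    fix l0 assume l0: "l0 \<in> A"
    obtain y where y: "y \<in> {a..b}" "\<And>x. x \<in> {a..b} \<Longrightarrow> U l0 y \<le> U l0 x"
      using continuous_attains_inf[OF compact_Icc _ cU[of l0]] ab by auto
    define e where "e = min (U l0 y) (V l0 b)"
    have "0 < e" using l0 y by (auto simp: A_def e_def)
    from near[OF this, of l0] obtain d where d: "0 < d"
      "\<And>l x. \<bar>l - l0\<bar> < d \<Longrightarrow> x \<in> {a..b} \<Longrightarrow> \<bar>U l x - U l0 x\<bar> < e \<and> \<bar>V l x - V l0 x\<bar> < e" by blast
    have "l \<in> A" if "\<bar>l - l0\<bar> < d" for l
      using d(2)[OF that] y(2) b unfolding A_def e_def by fastforce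
    then show "\<exists>e>0. \<forall>l. dist l l0 < e \<longrightarrow> l \<in> A"
      using d(1) by (auto simp: dist_real_def)
  qed
  moreover have "open B"
    unfolding open_dist
  proof
    fix l0 assume l0: "l0 \<in> B"
    show "\<exists>e>0. \<forall>l. dist l l0 < e \<longrightarrow> l \<in> B"
    proof (cases "V l0 b < 0")
      case True
      then obtain d where d: "0 < d"
        "\<And>l x. \<bar>l - l0\<bar> < d \<Longrightarrow> x \<in> {a..b} \<Longrightarrow> \<bar>V l x - V l0 x\<bar> < - V l0 b"
        using near[of "- V l0 b" l0] by auto
      have "l \<in> B" if "\<bar>l - l0\<bar> < d" for l
        using d(2)[OF that b] True unfolding B_def by auto
      then show ?thesis using d(1) by (auto simp: dist_real_def)
    next
      case False
      then obtain x where x: "x \<in> {a..b}" "U l0 x < 0" using l0 by (auto simp: B_def)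
      then obtain d where d: "0 < d"
        "\<And>l x'. \<bar>l - l0\<bar> < d \<Longrightarrow> x' \<in> {a..b} \<Longrightarrow> \<bar>U l x' - U l0 x'\<bar> < - U l0 x"
        using near[of "- U l0 x" l0] by auto
      have "l \<in> B" if "\<bar>l - l0\<bar> < d" for l
        using d(2)[OF that x(1)] x unfolding B_def by force
      then show ?thesis using d(1) by (auto simp: dist_real_def)
    qed
  qed
  \<comment> \<open>While \<open>c > l\<close>, the product \<open>u v\<close> increases from 0, hence \<open>u\<^sup>2\<close> increases from 1 and \<open>u\<close> cannot vanish.\<close>
  moreover have "- C - 1 \<in> A"
  proof -
    let ?l = "- C - 1"
    have q: "0 < p x * (c x - ?l)" if "x \<in> {a..b}" for x
      using p[OF that] C(2)[OF that] by (intro mult_pos_pos) auto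
    have UV: "0 \<le> U ?l x * V ?l x" if x: "x \<in> {a..b}" for x
    proof -
      have "U ?l a * V ?l a \<le> U ?l x * V ?l x"
      proof (rule nondecreasing_if_derivative_nonneg[of a b "\<lambda>x. U ?l x * V ?l x"
            "\<lambda>x. 1 / p x * (V ?l x)\<^sup>2 + p x * (c x - ?l) * (U ?l x)\<^sup>2" a x])
        fix t assume t: "t \<in> {a..b}"
        show "((\<lambda>x. U ?l x * V ?l x) has_real_derivative
           1 / p t * (V ?l t)\<^sup>2 + p t * (c t - ?l) * (U ?l t)\<^sup>2) (at t within {a..b})"
          by (rule derivative_eq_intros dU dV t refl)+ (simp add: power2_eq_square algebra_simps)
        show "0 \<le> 1 / p t * (V ?l t)\<^sup>2 + p t * (c t - ?l) * (U ?l t)\<^sup>2"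
          using p[OF t] less_imp_le[OF q[OF t]]
          by (intro add_nonneg_nonneg mult_nonneg_nonneg[OF _ zero_le_power2]) auto
      qed (use x in auto)
      then show ?thesis using init by simp
    qed
    have U2: "1 \<le> (U ?l x)\<^sup>2" if x: "x \<in> {a..b}" for x
    proof -
      have "(U ?l a)\<^sup>2 \<le> (U ?l x)\<^sup>2"
      proof (rule nondecreasing_if_derivative_nonneg[of a b "\<lambda>x. (U ?l x)\<^sup>2"
            "\<lambda>x. 2 * (U ?l x * V ?l x) / p x" a x])
        fix t assume t: "t \<in> {a..b}"
        show "((\<lambda>x. (U ?l x)\<^sup>2) has_real_derivative 2 * (U ?l t * V ?l t) / p t) (at t within {a..b})"
          by (rule derivative_eq_intros dU t refl)+ simp
        show "0 \<le> 2 * (U ?l t * V ?l t) / p t"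
          using p[OF t] UV[OF t] by simp
      qed (use x in auto)
      then show ?thesis using init by simp
    qed
    have Upos: "0 < U ?l x" if x: "x \<in> {a..b}" for x
    proof (rule ccontr)
      assume "\<not> 0 < U ?l x"
      then have "\<exists>y\<ge>a. y \<le> x \<and> U ?l y = 0"
        using x init by (intro IVT2') (auto intro: continuous_on_subset[OF cU])
      then obtain y where "a \<le> y" "y \<le> x" "U ?l y = 0" by blast
      then show False using U2[of y] x by simp
    qed
    have "V ?l a < V ?l b"
      using q Upos ab by (intro increasing_if_derivative_pos[OF dV]) auto
    then show ?thesis using Upos init by (auto simp: A_def)
  qed
  \<comment> \<open>While \<open>c < l\<close>, a positive \<open>u\<close> makes \<open>v\<close> strictly decreasing from 0.\<close>
  moreover have "C + 1 \<in> B"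
  proof (rule ccontr)
    let ?l = "C + 1"
    assume nB: "?l \<notin> B"
    then have nB': "\<not> V ?l b < 0" "\<not> (\<exists>x\<in>{a..b}. U ?l x < 0)" unfolding B_def by blast+
    have nn: "0 \<le> U ?l x" if "x \<in> {a..b}" for x using nB'(2) that not_less by blast
    have Vb: "0 \<le> V ?l b" using nB'(1) by simp
    have dV': "((\<lambda>x. - V ?l x) has_real_derivative - (p x * (c x - ?l) * U ?l x)) (at x within {a..b})"
      if "x \<in> {a..b}" for x
      using dV[OF that] by (rule DERIV_minus)
    have "- V ?l a < - V ?l b"
    proof (rule increasing_if_derivative_pos[OF dV'])
      fix x assume x: "x \<in> {a..b}"
      have "c x - ?l < 0" using C(2)[OF x] by auto
      then show "0 < - (p x * (c x - ?l) * U ?l x)"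
        using p[OF x] pos[OF nn Vb x] by (simp add: mult_less_0_iff zero_less_mult_iff)
    qed (use ab in auto)
    then show False using Vb init by simp
  qed
  moreover have "A \<inter> B = {}"
    by (force simp: A_def B_def)
  ultimately have "\<not> UNIV \<subseteq> A \<union> B"
    using connectedD[OF connected_UNIV[where 'a=real], of A B] by auto
  then obtain l where l: "l \<notin> A" "l \<notin> B" by auto
  then have nn: "\<And>x. x \<in> {a..b} \<Longrightarrow> 0 \<le> U l x" and Vb: "0 \<le> V l b"
    using l(2) not_less unfolding B_def by blast+
  have "\<forall>x\<in>{a..b}. 0 < U l x" using pos[OF nn Vb] by blast
  moreover from this have "V l b = 0" using l(1) Vb by (auto simp: A_def)
  ultimately show ?thesis using dU dV init by blast
qed

text \<open>
  With \<open>p = exp (2 s m)\<close> the shooting system for \<open>(u, p u')\<close> is the eigenvalue equation in divergence form.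
\<close>

lemma principal_eigenvalue_exists:
  assumes m: "C1_on {-1..1} m m'" and cc: "continuous_on {-1..1} c"
  shows "\<exists>l. has_positive_neumann_solution m' c s l"
proof -
  define p where "p x = exp (2 * s * m x)" for x
  have dm: "(m has_real_derivative m' x) (at x within {-1..1})" if "x \<in> {-1..1}" for x
    using m that by (auto simp: C1_on_def)
  have cm': "continuous_on {-1..1} m'" using m by (simp add: C1_on_def)
  have dp: "(p has_real_derivative 2 * s * m' x * p x) (at x within {-1..1})" if "x \<in> {-1..1}" for x
    unfolding p_def by (auto intro!: derivative_eq_intros dm that)
  have cp: "continuous_on {-1..1} p" using dp by (rule DERIV_continuous_on)
  have p: "0 < p x" for x by (simp add: p_def)
  have "\<exists>l u v. (\<forall>x\<in>{-1..1}. (u has_real_derivative 1 / p x * v x) (at x within {-1..1})) \<and>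
     (\<forall>x\<in>{-1..1}. (v has_real_derivative p x * (c x - l) * u x) (at x within {-1..1})) \<and>
     (\<forall>x\<in>{-1..1}. 0 < u x) \<and> v (-1) = 0 \<and> v 1 = 0"
    by (rule positive_neumann_shooting_exists[OF _ cp p cc]) simp
  then obtain l u v where du: "\<And>x. x \<in> {-1..1} \<Longrightarrow> (u has_real_derivative 1 / p x * v x) (at x within {-1..1})"
    and dv: "\<And>x. x \<in> {-1..1} \<Longrightarrow> (v has_real_derivative p x * (c x - l) * u x) (at x within {-1..1})"
    and pos: "\<forall>x\<in>{-1..1}. 0 < u x" and bc: "v (-1) = 0" "v 1 = 0"
    by blast
  define w where "w x = 1 / p x * v x" for x
  define w' where "w' x = (c x - l) * u x - 2 * s * m' x * w x" for x
  have dw: "(w has_real_derivative w' x) (at x within {-1..1})" if "x \<in> {-1..1}" for x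
  proof -
    have "((\<lambda>x. v x / p x) has_real_derivative
        (p x * (c x - l) * u x * p x - v x * (2 * s * m' x * p x)) / (p x * p x)) (at x within {-1..1})"
      using p[of x] by (intro DERIV_divide dv dp that) simp
    moreover have "(p x * (c x - l) * u x * p x - v x * (2 * s * m' x * p x)) / (p x * p x) = w' x"
      using p[of x] by (simp add: w'_def w_def field_simps)
    ultimately show ?thesis by (simp add: w_def[abs_def])
  qed
  have cu: "continuous_on {-1..1} u" using du by (rule DERIV_continuous_on)
  have cw: "continuous_on {-1..1} w" using dw by (rule DERIV_continuous_on)
  have "continuous_on {-1..1} w'"
    unfolding w'_def by (intro continuous_intros cu cw cc cm')
  then have "C1_on {-1..1} u w" "C1_on {-1..1} w w'"
    using du dw cw by (auto simp: C1_on_def w_def)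
  then have "has_positive_neumann_solution m' c s l"
    unfolding has_positive_neumann_solution_def using pos bc
    by (intro exI[of _ u] exI[of _ w] exI[of _ w']) (auto simp: w_def w'_def algebra_simps)
  then show ?thesis by blast
qed

text \<open>
  For positive solutions \<open>f\<close>, \<open>g\<close> with eigenvalues \<open>k > l\<close>, the weighted Wronskian
  \<open>exp (2 s m) (f g' - f' g)\<close> would be strictly increasing, yet it vanishes at both ends.
\<close>

lemma positive_neumann_eigenvalue_le:
  assumes m: "C1_on {-1..1} m m'"
    and k: "has_positive_neumann_solution m' c s k" and l: "has_positive_neumann_solution m' c s l"
  shows "k \<le> l"
proof (rule ccontr)
  assume "\<not> k \<le> l"
  then have lk: "l < k" by simp
  obtain f f' f'' where f: "C1_on {-1..1} f f'" "C1_on {-1..1} f' f''" "\<And>x. x \<in> {-1..1} \<Longrightarrow> f x > 0"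
     "\<And>x. x \<in> {-1..1} \<Longrightarrow> - f'' x - 2 * s * m' x * f' x + c x * f x = k * f x" "f' (-1) = 0" "f' 1 = 0"
    using k unfolding has_positive_neumann_solution_def by blast
  obtain g g' g'' where g: "C1_on {-1..1} g g'" "C1_on {-1..1} g' g''" "\<And>x. x \<in> {-1..1} \<Longrightarrow> g x > 0"
     "\<And>x. x \<in> {-1..1} \<Longrightarrow> - g'' x - 2 * s * m' x * g' x + c x * g x = l * g x" "g' (-1) = 0" "g' 1 = 0"
    using l unfolding has_positive_neumann_solution_def by blast
  let ?W = "\<lambda>x. exp (2 * s * m x) * (f x * g' x - f' x * g x)"
  have "?W (-1) < ?W 1"
  proof (rule increasing_if_derivative_pos[of "-1" 1 ?W "\<lambda>x. exp (2 * s * m x) * ((k - l) * (f x * g x))"])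
    fix x :: real assume x: "x \<in> {-1..1}"
    have d: "(m has_real_derivative m' x) (at x within {-1..1})"
      "(f has_real_derivative f' x) (at x within {-1..1})" "(f' has_real_derivative f'' x) (at x within {-1..1})"
      "(g has_real_derivative g' x) (at x within {-1..1})" "(g' has_real_derivative g'' x) (at x within {-1..1})"
      using m f(1,2) g(1,2) x by (auto simp: C1_on_def)
    have ode: "f'' x = (c x - k) * f x - 2 * s * m' x * f' x" "g'' x = (c x - l) * g x - 2 * s * m' x * g' x"
      using f(4)[OF x] g(4)[OF x] by (simp_all add: algebra_simps)
    show "(?W has_real_derivative exp (2 * s * m x) * ((k - l) * (f x * g x))) (at x within {-1..1})"
      by (rule derivative_eq_intros d refl)+ (simp add: ode algebra_simps)
    show "0 < exp (2 * s * m x) * ((k - l) * (f x * g x))"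
      using lk f(3)[OF x] g(3)[OF x] by simp
  qed auto
  then show False using f(5,6) g(5,6) by simp
qed

lemma has_positive_neumann_solution_principal_eigenvalue:
  assumes "C1_on {-1..1} m m'" and "continuous_on {-1..1} c"
  shows "has_positive_neumann_solution m' c s (principal_eigenvalue m' c s)"
proof -
  obtain l where "has_positive_neumann_solution m' c s l"
    using principal_eigenvalue_exists[OF assms] by blast
  then show ?thesis
    unfolding principal_eigenvalue_def
    by (rule theI) (use positive_neumann_eigenvalue_le[OF assms(1)] \<open>has_positive_neumann_solution m' c s l\<close>
        in \<open>blast intro: antisym\<close>)
qed

section \<open>The lower bound\<close>

text \<open>
  A comparison for Riccati equations that avoids dividing by \<open>f\<close>: if \<open>W' = w\<close>, then
  \<open>exp (2 s m + W) (f' - w f)\<close> has derivative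
  \<open>exp (2 s m + W) f (c - l - (w' + w\<^sup>2 + 2 s m' w))\<close>, which is positive.
\<close>

lemma barrier_comparison:
  assumes ab: "a < b" and m: "C1_on {a..b} m m'"
    and f: "C1_on {a..b} f f'" "C1_on {a..b} f' f''" "\<And>x. x \<in> {a..b} \<Longrightarrow> 0 < f x"
    and ode: "\<And>x. x \<in> {a..b} \<Longrightarrow> - f'' x - 2 * s * m' x * f' x + c x * f x = l * f x"
    and f'a: "f' a = 0"
    and w: "C1_on {a..b} w w'" and wa: "w a \<le> 0" and wb: "w b = 0"
    and riccati: "\<And>x. x \<in> {a..b} \<Longrightarrow> w' x + (w x)\<^sup>2 + 2 * s * m' x * w x \<le> c x - k"
    and lk: "l < k"
  shows "0 < f' b"
proof -
  have "continuous_on {a..b} w"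
    using w unfolding C1_on_def by (auto intro: DERIV_continuous_on)
  then have dW: "((\<lambda>x. integral {a..x} w) has_real_derivative w x) (at x within {a..b})"
    if "x \<in> {a..b}" for x
    using that by (rule integral_has_real_derivative)
  define W where "W x = integral {a..x} w" for x
  let ?F = "\<lambda>x. exp (2 * s * m x + W x) * (f' x - w x * f x)"
  let ?F' = "\<lambda>x. exp (2 * s * m x + W x) * (f x * (c x - l - (w' x + (w x)\<^sup>2 + 2 * s * m' x * w x)))"
  have "?F a < ?F b"
  proof (rule increasing_if_derivative_pos[of a b ?F ?F'])
    fix x assume x: "x \<in> {a..b}"
    have d: "(m has_real_derivative m' x) (at x within {a..b})"
      "(f has_real_derivative f' x) (at x within {a..b})" "(f' has_real_derivative f'' x) (at x within {a..b})"
      "(w has_real_derivative w' x) (at x within {a..b})" "(W has_real_derivative w x) (at x within {a..b})"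
      using m f(1,2) w x dW[OF x] by (auto simp: C1_on_def W_def[abs_def])
    have f'': "f'' x = (c x - l) * f x - 2 * s * m' x * f' x"
      using ode[OF x] by (simp add: algebra_simps)
    show "(?F has_real_derivative ?F' x) (at x within {a..b})"
      by (rule derivative_eq_intros d refl)+ (simp add: f'' algebra_simps power2_eq_square)
    show "0 < ?F' x"
      using riccati[OF x] lk f(3)[OF x] by (intro mult_pos_pos) auto
  qed (use ab in auto)
  moreover have "0 \<le> ?F a"
    using f'a wa f(3)[of a] ab by (simp add: mult_le_0_iff)
  ultimately have "0 < ?F b" by linarith
  then show ?thesis using wb by (simp add: zero_less_mult_iff)
qed

text \<open>
  The barrier is \<open>w x = - (b - x) h x\<close>, where \<open>h\<close> takes values in \<open>[\<eta>, 3 \<eta>]\<close> and is a constant plus steep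
  increasing steps of arctangent shape, one at each zero of \<open>m'\<close> before \<open>b\<close>. As \<open>h' \<ge> 0\<close>, the bound
  \<open>w' = h - (b - x) h' \<le> 3 \<eta>\<close> holds everywhere, and \<open>w' \<le> 3 \<eta> - (K + 1)\<close> at points of
  \<open>[a, b - d]\<close> within distance \<open>\<tau>\<close> of a zero, with \<open>K\<close> a bound for the variation of \<open>c\<close>. The points
  at distance at least \<open>d\<close> from \<open>b\<close> and at least \<open>\<tau>\<close> from all zeros form a compact set, on which \<open>m'\<close> has a
  positive lower bound and the drift term beats \<open>K\<close> for large \<open>s\<close>. The sign of \<open>w\<close> makes the drift term
  harmless elsewhere.
\<close>

lemma barrier_exists:
  fixes c m' :: "real \<Rightarrow> real"
  assumes ab: "a < b" and cm': "continuous_on {a..b} m'" and cc: "continuous_on {a..b} c"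
    and m'nn: "\<And>x. x \<in> {a..<b} \<Longrightarrow> 0 \<le> m' x"
    and fin: "finite {x \<in> {a..<b}. m' x = 0}" and e: "0 < e"
  shows "\<exists>w w' S. C1_on {a..b} w w' \<and> w a \<le> 0 \<and> w b = 0 \<and>
    (\<forall>s\<ge>S. \<forall>x\<in>{a..b}. w' x + (w x)\<^sup>2 + 2 * s * m' x * w x \<le> c x - (c b - e))"
proof -
  define Z where "Z = {x \<in> {a..<b}. m' x = 0}"
  define L where "L = b - a"
  have L: "0 < L" using ab by (simp add: L_def)
  have bI: "b \<in> {a..b}" using ab by simp
  obtain C where C: "0 < C" "\<And>x. x \<in> {a..b} \<Longrightarrow> \<bar>c x\<bar> \<le> C"
    using continuous_on_Icc_bounded[OF cc] by blast
  define K where "K = 2 * C"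
  have K: "0 < K" using C by (simp add: K_def)
  have cK: "- K \<le> c x - c b" if "x \<in> {a..b}" for x
    using C(2)[OF that] C(2)[OF bI] by (simp add: K_def abs_le_iff)
  obtain d where d: "0 < d" "\<And>x. x \<in> {a..b} \<Longrightarrow> \<bar>x - b\<bar> < d \<Longrightarrow> \<bar>c x - c b\<bar> < e / 2"
    using cc[unfolded continuous_on_iff dist_real_def] bI e half_gt_zero by metis
  \<comment> \<open>Small enough for \<open>w' + w\<^sup>2 \<le> e / 2\<close> on the whole interval; the cap at 1 gives \<open>\<eta>\<^sup>2 \<le> \<eta>\<close>.\<close>
  define \<eta> where "\<eta> = min 1 (e / (2 * (3 + 9 * L\<^sup>2)))"
  have \<eta>0: "0 < \<eta>" using e by (simp add: \<eta>_def add_pos_nonneg)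
  have \<eta>e: "3 * \<eta> + (3 * \<eta> * L)\<^sup>2 \<le> e / 2"
  proof -
    have "\<eta> \<le> 1" by (simp add: \<eta>_def)
    then have "\<eta>\<^sup>2 \<le> \<eta>" using \<eta>0 by (simp add: power2_eq_square mult_left_le)
    then have "9 * L\<^sup>2 * \<eta>\<^sup>2 \<le> 9 * L\<^sup>2 * \<eta>" by (intro mult_left_mono) auto
    moreover have "(3 + 9 * L\<^sup>2) * \<eta> \<le> e / 2"
    proof -
      have "(3 + 9 * L\<^sup>2) * \<eta> \<le> (3 + 9 * L\<^sup>2) * (e / (2 * (3 + 9 * L\<^sup>2)))"
        by (intro mult_left_mono) (auto simp: \<eta>_def)
      also have "\<dots> = e / 2"
        using add_pos_nonneg[of 3 "9 * L\<^sup>2"] by (simp add: field_simps)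
      finally show ?thesis .
    qed
    ultimately show ?thesis by (simp add: power_mult_distrib algebra_simps)
  qed
  \<comment> \<open>Each arctangent is at most 2 in absolute value, so the weight \<open>\<rho>\<close> keeps their sum within \<open>[-1, 1]\<close>.\<close>
  define \<rho> where "\<rho> = 1 / (2 * (real (card Z) + 1))"
  have \<rho>: "0 < \<rho>" by (simp add: \<rho>_def add_nonneg_pos)
  \<comment> \<open>At distance \<open>\<tau>\<close> from its centre a step contributes \<open>\<eta> \<rho> / (2 \<tau>) = (K + 1) / d\<close> to \<open>h'\<close>.\<close>
  define \<tau> where "\<tau> = d * \<eta> * \<rho> / (2 * (K + 1))"
  have \<tau>: "0 < \<tau>" using d \<eta>0 \<rho> K by (simp add: \<tau>_def)
  define h where "h x = \<eta> * (2 + (\<Sum>z\<in>Z. \<rho> * arctan ((x - z) / \<tau>)))" for x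
  define h' where "h' x = \<eta> * (\<Sum>z\<in>Z. \<rho> / (\<tau> * (1 + ((x - z) / \<tau>)\<^sup>2)))" for x
  have sq: "0 < 1 + y\<^sup>2" for y :: real by (simp add: add_pos_nonneg)
  have dh: "(h has_real_derivative h' x) (at x within A)" for x A
  proof -
    have "((\<lambda>x. arctan ((x - z) / \<tau>)) has_real_derivative 1 / (\<tau> * (1 + ((x - z) / \<tau>)\<^sup>2))) (at x within A)" for z
      using \<tau> sq[of "(x - z) / \<tau>"] by (auto intro!: derivative_eq_intros simp: field_simps)
    then have "(h has_real_derivative \<eta> * (0 + (\<Sum>z\<in>Z. \<rho> * (1 / (\<tau> * (1 + ((x - z) / \<tau>)\<^sup>2)))))) (at x within A)"
      unfolding h_def by (intro DERIV_cmult DERIV_add DERIV_const DERIV_sum) auto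
    then show ?thesis by (simp add: h'_def)
  qed
  have ch': "continuous_on A h'" for A
    unfolding h'_def using \<tau> sq by (intro continuous_intros) (auto simp: less_imp_neq[THEN not_sym])
  have h'nn: "0 \<le> h' x" for x
    unfolding h'_def using \<eta>0 \<rho> \<tau> sq
    by (intro mult_nonneg_nonneg sum_nonneg divide_nonneg_nonneg) (auto intro: less_imp_le)
  have hbd: "\<eta> \<le> h x" "h x \<le> 3 * \<eta>" for x
  proof -
    have "\<bar>\<Sum>z\<in>Z. \<rho> * arctan ((x - z) / \<tau>)\<bar> \<le> (\<Sum>z\<in>Z. \<bar>\<rho> * arctan ((x - z) / \<tau>)\<bar>)"
      by (rule sum_abs)
    also have "\<dots> \<le> (\<Sum>z\<in>Z. \<rho> * 2)"
    proof (rule sum_mono)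
      fix z
      have "\<bar>arctan ((x - z) / \<tau>)\<bar> \<le> 2"
        using arctan_ubound[of "(x - z) / \<tau>"] arctan_lbound[of "(x - z) / \<tau>"] pi_less_4 by simp
      then show "\<bar>\<rho> * arctan ((x - z) / \<tau>)\<bar> \<le> \<rho> * 2"
        using \<rho> by (simp add: abs_mult)
    qed
    also have "\<dots> \<le> 1"
      by (simp add: \<rho>_def field_simps)
    finally have *: "1 \<le> 2 + (\<Sum>z\<in>Z. \<rho> * arctan ((x - z) / \<tau>))" "2 + (\<Sum>z\<in>Z. \<rho> * arctan ((x - z) / \<tau>)) \<le> 3"
      by (auto simp: abs_le_iff)
    show "\<eta> \<le> h x" "h x \<le> 3 * \<eta>"
      using mult_left_mono[OF *(1), of \<eta>] mult_left_mono[OF *(2), of \<eta>] \<eta>0 by (simp_all add: h_def)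
  qed
  have h'Z: "K + 1 \<le> d * h' x" if z: "z \<in> Z" "\<bar>x - z\<bar> \<le> \<tau>" for x z
  proof -
    have "((x - z) / \<tau>)\<^sup>2 \<le> 1"
      using z(2) \<tau> by (simp add: abs_square_le_1)
    then have "\<rho> / (\<tau> * 2) \<le> \<rho> / (\<tau> * (1 + ((x - z) / \<tau>)\<^sup>2))"
      using \<rho> \<tau> sq[of "(x - z) / \<tau>"] by (intro divide_left_mono mult_left_mono mult_pos_pos) auto
    also have "\<dots> \<le> (\<Sum>z\<in>Z. \<rho> / (\<tau> * (1 + ((x - z) / \<tau>)\<^sup>2)))"
      using z(1) fin \<rho> \<tau> by (intro member_le_sum) (auto simp: Z_def)
    finally have "d * (\<eta> * (\<rho> / (\<tau> * 2))) \<le> d * h' x"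
      unfolding h'_def using d \<eta>0 by (intro mult_left_mono) auto
    moreover have "d * (\<eta> * (\<rho> / (\<tau> * 2))) = K + 1"
      using d \<eta>0 \<rho> K by (simp add: \<tau>_def field_simps)
    ultimately show ?thesis by simp
  qed
  define Q where "Q = {a..b - d} \<inter> (\<Inter>z\<in>Z. {x. \<tau> \<le> \<bar>x - z\<bar>})"
  have "closed (\<Inter>z\<in>Z. {x. \<tau> \<le> \<bar>x - z\<bar>})"
    by (intro closed_INT ballI closed_Collect_le continuous_intros)
  then have cQ: "compact Q" unfolding Q_def by (intro compact_Int_closed compact_Icc)
  have Qab: "Q \<subseteq> {a..<b}" using d by (auto simp: Q_def)
  have m'Q: "0 < m' x" if "x \<in> Q" for x
  proof -
    have "x \<notin> Z" using that \<tau> by (force simp: Q_def)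
    then show ?thesis using that Qab m'nn[of x] by (force simp: Z_def)
  qed
  obtain \<mu> where \<mu>: "0 < \<mu>" "\<And>x. x \<in> Q \<Longrightarrow> \<mu> \<le> m' x"
  proof (cases "Q = {}")
    case False
    have "continuous_on Q m'" by (rule continuous_on_subset[OF cm' order_trans[OF Qab]]) auto
    from continuous_attains_inf[OF cQ False this] obtain x where "x \<in> Q" "\<forall>y\<in>Q. m' x \<le> m' y" by blast
    then show ?thesis using that m'Q by blast
  qed (use that[of 1] in auto)
  define S where "S = K / (2 * \<mu> * d * \<eta>)"
  have S0: "0 < S" using K \<mu> d \<eta>0 by (simp add: S_def)
  define w where "w x = - ((b - x) * h x)" for x
  define w' where "w' x = h x - (b - x) * h' x" for x
  have dw: "(w has_real_derivative w' x) (at x within A)" for x A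
    unfolding w_def w'_def by (auto intro!: derivative_eq_intros dh)
  have "continuous_on {a..b} h" using dh by (rule DERIV_continuous_on)
  then have "continuous_on {a..b} w'" unfolding w'_def by (intro continuous_intros ch')
  then have "C1_on {a..b} w w'" using dw by (simp add: C1_on_def)
  moreover have "w a \<le> 0" using hbd(1)[of a] \<eta>0 ab by (simp add: w_def)
  moreover have "w b = 0" by (simp add: w_def)
  moreover have "w' x + (w x)\<^sup>2 + 2 * s * m' x * w x \<le> c x - (c b - e)" if s: "S \<le> s" and x: "x \<in> {a..b}" for s x
  proof -
    have w2: "(w x)\<^sup>2 \<le> (3 * \<eta> * L)\<^sup>2"
    proof -
      have "(b - x) * h x \<le> L * (3 * \<eta>)"
        using x hbd[of x] \<eta>0 L by (intro mult_mono) (auto simp: L_def)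
      moreover have "0 \<le> (b - x) * h x" using x hbd[of x] \<eta>0 by simp
      ultimately have "((b - x) * h x)\<^sup>2 \<le> (L * (3 * \<eta>))\<^sup>2" by (intro power_mono)
      then show ?thesis by (simp add: w_def mult_ac)
    qed
    have w'h: "w' x \<le> 3 * \<eta>"
    proof -
      have "0 \<le> (b - x) * h' x" using x h'nn[of x] by (intro mult_nonneg_nonneg) auto
      then show ?thesis using hbd(2)[of x] unfolding w'_def by linarith
    qed
    have drift: "2 * s * m' x * w x \<le> 0"
    proof (cases "x = b")
      case False
      then have "0 \<le> m' x" using m'nn x by simp
      moreover have "w x \<le> 0" using x hbd(1)[of x] \<eta>0 by (simp add: w_def)
      ultimately show ?thesis using s S0 by (simp add: mult_nonneg_nonpos)
    qed (simp add: w_def)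
    consider "b - d < x" | z where "z \<in> Z" "x \<le> b - d" "\<bar>x - z\<bar> \<le> \<tau>" | "x \<in> Q"
      using x by (auto simp: Q_def not_less) (metis linear not_less)
    then show ?thesis
    proof cases
      case 1
      then have "\<bar>x - b\<bar> < d" using x by simp
      from d(2)[OF x this] have "- (e / 2) < c x - c b" by linarith
      then show ?thesis using w2 w'h drift \<eta>e by linarith
    next
      case (2 z)
      have "d * h' x \<le> (b - x) * h' x" using 2 h'nn by (intro mult_right_mono) auto
      then have "w' x \<le> 3 * \<eta> - (K + 1)"
        using h'Z[OF 2(1,3)] hbd(2)[of x] unfolding w'_def by linarith
      then show ?thesis using w2 drift \<eta>e cK[OF x] e by linarith
    next
      case 3
      have "d * \<eta> \<le> (b - x) * h x"
        using 3 d \<eta>0 hbd(1)[of x] by (intro mult_mono) (auto simp: Q_def)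
      then have "\<mu> * (d * \<eta>) \<le> m' x * ((b - x) * h x)"
        using \<mu>(1) d(1) \<eta>0 by (intro mult_mono[OF \<mu>(2)[OF 3]]) (use \<mu>(2)[OF 3] in auto)
      then have "S * (\<mu> * (d * \<eta>)) \<le> s * (m' x * ((b - x) * h x))"
        using s S0 \<mu>(1) d(1) \<eta>0 by (intro mult_mono[OF s]) auto
      moreover have "S * (\<mu> * (d * \<eta>)) = K / 2"
        using \<mu> d \<eta>0 by (simp add: S_def field_simps)
      moreover have "2 * s * m' x * w x = - 2 * (s * (m' x * ((b - x) * h x)))"
        by (simp add: w_def)
      ultimately have "2 * s * m' x * w x \<le> - K" by linarith
      then show ?thesis using w2 w'h \<eta>e cK[OF x] e by linarith
    qed
  qed
  ultimately show ?thesis by blast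
qed

lemma C1_on_subset: "C1_on S f f' \<Longrightarrow> T \<subseteq> S \<Longrightarrow> C1_on T f f'"
  unfolding C1_on_def by (meson continuous_on_subset has_field_derivative_subset subsetD)

lemma C1_on_uminus: "C1_on S f f' \<Longrightarrow> C1_on S (\<lambda>x. - f x) (\<lambda>x. - f' x)"
  unfolding C1_on_def by (auto intro!: DERIV_minus continuous_intros)

lemma C1_on_reflect:
  assumes "C1_on {a..b} f f'"
  shows "C1_on {- b..- a} (\<lambda>x. f (- x)) (\<lambda>x. - f' (- x))"
proof -
  have "((\<lambda>x. f (- x)) has_real_derivative f' (- x) * (-1)) (at x within {- b..- a})"
    if "x \<in> {- b..- a}" for x
  proof (rule DERIV_image_chain[where f=f and g=uminus, unfolded o_def])
    show "(f has_real_derivative f' (- x)) (at (- x) within uminus ` {- b..- a})"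
      using assms that by (auto simp: C1_on_def)
  qed (auto intro!: derivative_eq_intros)
  moreover have "continuous_on {- b..- a} (\<lambda>x. - f' (- x))"
    using assms by (auto simp: C1_on_def intro!: continuous_intros continuous_on_compose2[of "{a..b}" f'])
  ultimately show ?thesis by (simp add: C1_on_def)
qed

text \<open>
  A single barrier serves all eigenpairs: the threshold \<open>S\<close> precedes the eigenpair because the
  barrier depends neither on \<open>s\<close> nor on the eigenfunction.
\<close>

lemma eigenfunction_increasing_at_maximum:
  fixes c m m' :: "real \<Rightarrow> real"
  assumes ab: "a < b" and m: "C1_on {a..b} m m'" and cc: "continuous_on {a..b} c"
    and m'nn: "\<And>x. x \<in> {a..<b} \<Longrightarrow> 0 \<le> m' x"
    and fin: "finite {x \<in> {a..<b}. m' x = 0}" and e: "0 < e"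
  shows "\<exists>S. \<forall>s\<ge>S. \<forall>l f f' f''. C1_on {a..b} f f' \<longrightarrow> C1_on {a..b} f' f'' \<longrightarrow>
    (\<forall>x\<in>{a..b}. 0 < f x) \<longrightarrow>
    (\<forall>x\<in>{a..b}. - f'' x - 2 * s * m' x * f' x + c x * f x = l * f x) \<longrightarrow>
    f' a = 0 \<longrightarrow> l < c b - e \<longrightarrow> 0 < f' b"
proof -
  have cm': "continuous_on {a..b} m'" using m by (simp add: C1_on_def)
  obtain w w' S where w: "C1_on {a..b} w w'" "w a \<le> 0" "w b = 0"
    "\<And>s x. S \<le> s \<Longrightarrow> x \<in> {a..b} \<Longrightarrow> w' x + (w x)\<^sup>2 + 2 * s * m' x * w x \<le> c x - (c b - e)"
    using barrier_exists[OF ab cm' cc m'nn fin e] by blast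
  show ?thesis
    by (rule exI[of _ S]) (use barrier_comparison[OF ab m _ _ _ _ _ w(1,2,3,4)] in blast)
qed

text \<open>
  If \<open>l < c x0 - e\<close>, the slope of the eigenfunction at \<open>x0\<close> is positive by the argument on \<open>[-1, x0]\<close>; after
  the reflection \<open>x \<mapsto> - x\<close> the same argument on \<open>[x0, 1]\<close> makes it negative.
\<close>

lemma principal_eigenvalue_lower_bound:
  assumes cc: "continuous_on {-1..1} c" and Hm: "cond_Hm m m' x0" and e: "0 < e"
  shows "\<exists>S. \<forall>s\<ge>S. \<forall>l. has_positive_neumann_solution m' c s l \<longrightarrow> c x0 - e \<le> l"
proof -
  have m: "C1_on {-1..1} m m'" and x0: "-1 < x0" "x0 < 1"
    and inc: "\<And>x. x \<in> {-1..<x0} \<Longrightarrow> 0 \<le> m' x" and dec: "\<And>x. x \<in> {x0<..1} \<Longrightarrow> m' x \<le> 0"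
    and fin: "finite {x \<in> {-1<..<1}. m' x = 0}"
    using Hm by (auto simp: cond_Hm_def)
  have fin': "finite {x \<in> {-1..1}. m' x = 0}"
    by (rule finite_subset[of _ "insert (-1) (insert 1 {x \<in> {-1<..<1}. m' x = 0})"]) (use fin in auto)
  let ?n = "\<lambda>x. - m' (- x)" and ?d = "\<lambda>x. c (- x)"
  have "\<exists>S. \<forall>s\<ge>S. \<forall>l f f' f''. C1_on {-1..x0} f f' \<longrightarrow> C1_on {-1..x0} f' f'' \<longrightarrow>
    (\<forall>x\<in>{-1..x0}. 0 < f x) \<longrightarrow>
    (\<forall>x\<in>{-1..x0}. - f'' x - 2 * s * m' x * f' x + c x * f x = l * f x) \<longrightarrow>
    f' (-1) = 0 \<longrightarrow> l < c x0 - e \<longrightarrow> 0 < f' x0"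
  proof (rule eigenfunction_increasing_at_maximum)
    show "C1_on {-1..x0} m m'" using C1_on_subset[OF m] x0 by auto
    show "continuous_on {-1..x0} c" using cc x0 by (auto intro: continuous_on_subset)
    show "finite {x \<in> {-1..<x0}. m' x = 0}"
      by (rule finite_subset[OF _ fin']) (use x0 in auto)
  qed (use x0 inc e in auto)
  then obtain S1 where left: "\<And>s l f f' f''. S1 \<le> s \<Longrightarrow> C1_on {-1..x0} f f' \<Longrightarrow> C1_on {-1..x0} f' f'' \<Longrightarrow>
    (\<forall>x\<in>{-1..x0}. 0 < f x) \<Longrightarrow>
    (\<forall>x\<in>{-1..x0}. - f'' x - 2 * s * m' x * f' x + c x * f x = l * f x) \<Longrightarrow>
    f' (-1) = 0 \<Longrightarrow> l < c x0 - e \<Longrightarrow> 0 < f' x0" by blast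
  have sub: "{x0..1} \<subseteq> {-1..1}" using x0 by auto
  have "\<exists>S. \<forall>s\<ge>S. \<forall>l f f' f''. C1_on {-1..-x0} f f' \<longrightarrow> C1_on {-1..-x0} f' f'' \<longrightarrow>
    (\<forall>x\<in>{-1..-x0}. 0 < f x) \<longrightarrow>
    (\<forall>x\<in>{-1..-x0}. - f'' x - 2 * s * ?n x * f' x + ?d x * f x = l * f x) \<longrightarrow>
    f' (-1) = 0 \<longrightarrow> l < ?d (-x0) - e \<longrightarrow> 0 < f' (-x0)"
  proof (rule eigenfunction_increasing_at_maximum)
    show "C1_on {-1..-x0} (\<lambda>x. m (- x)) ?n" using C1_on_reflect[OF C1_on_subset[OF m sub]] .
    show "continuous_on {-1..-x0} ?d"
      using cc x0 by (auto intro!: continuous_intros continuous_on_compose2[of "{-1..1}" c])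
    have "{x \<in> {-1..<-x0}. ?n x = 0} \<subseteq> uminus ` {x \<in> {-1..1}. m' x = 0}"
      using x0 by (auto simp: image_iff) (smt (verit))
    then show "finite {x \<in> {-1..<-x0}. ?n x = 0}"
      by (rule finite_subset) (use fin' in simp)
    show "0 \<le> ?n x" if "x \<in> {-1..<-x0}" for x using dec[of "-x"] that by simp
  qed (use x0 e in auto)
  then obtain S2 where right: "\<And>s l f f' f''. S2 \<le> s \<Longrightarrow> C1_on {-1..-x0} f f' \<Longrightarrow> C1_on {-1..-x0} f' f'' \<Longrightarrow>
    (\<forall>x\<in>{-1..-x0}. 0 < f x) \<Longrightarrow>
    (\<forall>x\<in>{-1..-x0}. - f'' x - 2 * s * ?n x * f' x + ?d x * f x = l * f x) \<Longrightarrow>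
    f' (-1) = 0 \<Longrightarrow> l < ?d (-x0) - e \<Longrightarrow> 0 < f' (-x0)" by blast
  have "c x0 - e \<le> l" if s: "max S1 S2 \<le> s" and sol: "has_positive_neumann_solution m' c s l" for s l
  proof (rule ccontr)
    assume "\<not> c x0 - e \<le> l"
    then have l: "l < c x0 - e" by simp
    obtain f f' f'' where f: "C1_on {-1..1} f f'" "C1_on {-1..1} f' f''" "\<And>x. x \<in> {-1..1} \<Longrightarrow> f x > 0"
     "\<And>x. x \<in> {-1..1} \<Longrightarrow> - f'' x - 2 * s * m' x * f' x + c x * f x = l * f x" "f' (-1) = 0" "f' 1 = 0"
      using sol unfolding has_positive_neumann_solution_def by blast
    have "0 < f' x0"
    proof (rule left[of s f f' f'' l])
      show "C1_on {-1..x0} f f'" "C1_on {-1..x0} f' f''"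
        using C1_on_subset[OF f(1)] C1_on_subset[OF f(2)] x0 by auto
    qed (use s f l x0 in auto)
    moreover have "0 < - f' (- (- x0))"
    proof (rule right[of s "\<lambda>x. f (- x)" "\<lambda>x. - f' (- x)" "\<lambda>x. - (- f'' (- x))" l])
      show "C1_on {-1..-x0} (\<lambda>x. f (- x)) (\<lambda>x. - f' (- x))"
        using C1_on_reflect[OF C1_on_subset[OF f(1) sub]] .
      show "C1_on {-1..-x0} (\<lambda>x. - f' (- x)) (\<lambda>x. - (- f'' (- x)))"
        by (rule C1_on_uminus[OF C1_on_reflect[OF C1_on_subset[OF f(2) sub]]])
      show "\<forall>x\<in>{-1..-x0}. - (- (- f'' (- x))) - 2 * s * - m' (- x) * - f' (- x) + c (- x) * f (- x) = l * f (- x)"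
      proof
        fix x assume "x \<in> {-1..-x0}"
        then have "- x \<in> {-1..1}" using x0 by auto
        from f(4)[OF this] 
        show "- (- (- f'' (- x))) - 2 * s * - m' (- x) * - f' (- x) + c (- x) * f (- x) = l * f (- x)"
          by simp
      qed
    qed (use s f l x0 in auto)
    ultimately show False by simp
  qed
  then show ?thesis by blast
qed

section \<open>The upper bound\<close>

text \<open>
  Away from \<open>x0\<close> the integrand is at most of order \<open>exp (s \<mu>)\<close> with \<open>\<mu> < m x0\<close>; near \<open>x0\<close> it is
  negative, and on a short interval at \<open>x0\<close> it is at most \<open>- \<kappa> exp (s \<nu>)\<close> for a level \<open>\<nu>\<close> strictly between \<open>\<mu>\<close>
  and \<open>m x0\<close>. This negative part dominates for large \<open>s\<close>.
\<close>

lemma laplace_concentration: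
  fixes m g :: "real \<Rightarrow> real"
  assumes cm: "continuous_on {a..b} m" and cg: "continuous_on {a..b} g"
    and x0: "a < x0" "x0 < b" and strict: "\<And>x. x \<in> {a..b} \<Longrightarrow> x \<noteq> x0 \<Longrightarrow> m x < m x0"
    and g: "g x0 < 0"
  shows "\<forall>\<^sub>F s in at_top. integral {a..b} (\<lambda>x. exp (s * m x) * g x) < 0"
proof -
  have x0I: "x0 \<in> {a..b}" using x0 by simp
  obtain G where G: "0 < G" "\<And>x. x \<in> {a..b} \<Longrightarrow> \<bar>g x\<bar> \<le> G"
    using continuous_on_Icc_bounded[OF cg] by blast
  define \<kappa> where "\<kappa> = - g x0 / 2"
  have \<kappa>: "0 < \<kappa>" using g by (simp add: \<kappa>_def)
  obtain d where d: "0 < d" "\<And>x. x \<in> {a..b} \<Longrightarrow> \<bar>x - x0\<bar> < d \<Longrightarrow> \<bar>g x - g x0\<bar> < \<kappa>"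
    using cg[unfolded continuous_on_iff dist_real_def] x0I \<kappa> by metis
  define Q where "Q = {a..b} \<inter> {x. d \<le> \<bar>x - x0\<bar>}"
  have cQ: "compact Q" unfolding Q_def
    by (intro compact_Int_closed compact_Icc closed_Collect_le continuous_intros)
  obtain \<mu> where \<mu>: "\<mu> < m x0" "\<And>x. x \<in> Q \<Longrightarrow> m x \<le> \<mu>"
  proof (cases "Q = {}")
    case False
    have "continuous_on Q m" using cm by (auto intro: continuous_on_subset simp: Q_def)
    from continuous_attains_sup[OF cQ False this] obtain x where x: "x \<in> Q" "\<forall>y\<in>Q. m y \<le> m x" by blast
    then have "m x < m x0" using d(1) by (intro strict) (auto simp: Q_def)
    then show ?thesis using that x by blast
  qed (use that[of "m x0 - 1"] in auto)
  define \<nu> where "\<nu> = (m x0 + \<mu>) / 2"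
  have \<nu>: "\<mu> < \<nu>" "\<nu> < m x0" using \<mu>(1) by (simp_all add: \<nu>_def)
  have "0 < m x0 - \<nu>" using \<nu>(2) by simp
  then obtain r where r: "0 < r" "\<And>x. x \<in> {a..b} \<Longrightarrow> \<bar>x - x0\<bar> < r \<Longrightarrow> \<bar>m x - m x0\<bar> < m x0 - \<nu>"
    using cm[unfolded continuous_on_iff dist_real_def] x0I by metis
  define h where "h = min (min d r / 2) (b - x0)"
  have h: "0 < h" "h < d" "h < r" "x0 + h \<le> b" using d(1) r(1) x0 by (auto simp: h_def min_def)
  have peak: "exp (s * m x) * g x \<le> - \<kappa> * exp (s * \<nu>)" if "x \<in> {x0..x0 + h}" "0 \<le> s" for x s
  proof -
    have x: "x \<in> {a..b}" "\<bar>x - x0\<bar> < d" "\<bar>x - x0\<bar> < r" using that h x0 by auto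
    have "\<kappa> \<le> - g x" using d(2)[OF x(1,2)] by (simp add: \<kappa>_def abs_less_iff)
    moreover have "exp (s * \<nu>) \<le> exp (s * m x)"
      using r(2)[OF x(1,3)] that(2) by (auto intro!: mult_left_mono simp: abs_less_iff)
    ultimately have "\<kappa> * exp (s * \<nu>) \<le> (- g x) * exp (s * m x)"
      using \<kappa> by (intro mult_mono) auto
    then show ?thesis by (simp add: mult.commute)
  qed
  have tail: "exp (s * m x) * g x \<le> G * exp (s * \<mu>)" if x: "x \<in> {a..b}" and s: "0 \<le> s" for x s
  proof (cases "x \<in> Q")
    case True
    have "exp (s * m x) * g x \<le> exp (s * m x) * G"
      using G(2)[OF x] by (intro mult_left_mono) auto
    also have "\<dots> \<le> exp (s * \<mu>) * G"
      using \<mu>(2)[OF True] s G(1) by (intro mult_right_mono) (auto intro!: mult_left_mono)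
    finally show ?thesis by (simp add: mult.commute)
  next
    case False
    then have "\<bar>x - x0\<bar> < d" using x by (simp add: Q_def)
    then have "g x < 0" using d(2)[OF x] g by (simp add: \<kappa>_def abs_less_iff)
    then have "exp (s * m x) * g x \<le> 0" by (simp add: mult_le_0_iff)
    also have "0 \<le> G * exp (s * \<mu>)" using G(1) by simp
    finally show ?thesis .
  qed
  have bound: "integral {a..b} (\<lambda>x. exp (s * m x) * g x) \<le> G * exp (s * \<mu>) * (b - a) - \<kappa> * exp (s * \<nu>) * h"
    if s: "0 \<le> s" for s
  proof -
    have "((\<lambda>x. exp (s * m x) * g x) has_integral integral {a..b} (\<lambda>x. exp (s * m x) * g x)) {a..b}"
      by (intro integrable_integral integrable_continuous_real continuous_intros cm cg)
    moreover have "((\<lambda>x. G * exp (s * \<mu>) + (if x \<in> {x0..x0 + h} then - \<kappa> * exp (s * \<nu>) else 0))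
        has_integral (G * exp (s * \<mu>) * (b - a) + (- \<kappa> * exp (s * \<nu>)) * h)) {a..b}"
    proof (rule has_integral_add)
      show "((\<lambda>x. G * exp (s * \<mu>)) has_integral G * exp (s * \<mu>) * (b - a)) {a..b}"
        using has_integral_const_real[of "G * exp (s * \<mu>)" a b] x0 by (simp add: mult_ac)
      have "((\<lambda>x. - \<kappa> * exp (s * \<nu>)) has_integral (- \<kappa> * exp (s * \<nu>)) * h) {x0..x0 + h}"
        using has_integral_const_real[of "- \<kappa> * exp (s * \<nu>)" x0 "x0 + h"] h by (simp add: mult_ac)
      then show "((\<lambda>x. if x \<in> {x0..x0 + h} then - \<kappa> * exp (s * \<nu>) else 0)
          has_integral (- \<kappa> * exp (s * \<nu>)) * h) {a..b}"
        using x0 h by (subst has_integral_restrict) auto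
    qed
    ultimately have "integral {a..b} (\<lambda>x. exp (s * m x) * g x)
        \<le> G * exp (s * \<mu>) * (b - a) + (- \<kappa> * exp (s * \<nu>)) * h"
    proof (rule has_integral_le)
      fix x assume x: "x \<in> {a..b}"
      have "0 \<le> G * exp (s * \<mu>)" using G(1) by simp
      then show "exp (s * m x) * g x \<le> G * exp (s * \<mu>) + (if x \<in> {x0..x0 + h} then - \<kappa> * exp (s * \<nu>) else 0)"
        using peak[of x s] tail[OF x s] s by (cases "x \<in> {x0..x0 + h}") auto
    qed
    then show ?thesis by simp
  qed
  have "filterlim (\<lambda>s. s * (\<nu> - \<mu>)) at_top at_top"
    using filterlim_tendsto_pos_mult_at_top[OF tendsto_const[of "\<nu> - \<mu>"] _ filterlim_ident] \<nu>(1)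
    by (simp add: mult.commute)
  then have "filterlim (\<lambda>s. exp (s * (\<nu> - \<mu>))) at_top at_top"
    by (rule filterlim_compose[OF exp_at_top])
  then have "\<forall>\<^sub>F s in at_top. G * (b - a) / (\<kappa> * h) < exp (s * (\<nu> - \<mu>))"
    by (simp add: filterlim_at_top_dense)
  moreover have "\<forall>\<^sub>F s::real in at_top. 0 \<le> s" by (rule eventually_ge_at_top)
  ultimately show ?thesis
  proof eventually_elim
    case (elim s)
    have "G * (b - a) < exp (s * (\<nu> - \<mu>)) * (\<kappa> * h)"
      using elim(1) \<kappa> h(1) by (simp add: pos_divide_less_eq)
    then have "G * (b - a) * exp (s * \<mu>) < exp (s * (\<nu> - \<mu>)) * (\<kappa> * h) * exp (s * \<mu>)"
      by (intro mult_strict_right_mono) auto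
    also have "\<dots> = \<kappa> * exp (s * \<nu>) * h"
      by (simp add: right_diff_distrib exp_diff)
    finally have "G * exp (s * \<mu>) * (b - a) - \<kappa> * exp (s * \<nu>) * h < 0" by (simp add: mult_ac)
    then show ?case using bound[OF elim(2)] by linarith
  qed
qed

text \<open>
  Uniqueness of the maximum point is assumed among interior points, so a value at an end point of the
  interval has to be compared with an interior one: by monotonicity the midpoint \<open>y\<close> of \<open>x\<close> and \<open>x0\<close>
  satisfies \<open>m x \<le> m y\<close>, and \<open>y\<close> is an interior point other than \<open>x0\<close>.
\<close>

lemma cond_Hm_strict_maximum:
  assumes Hm: "cond_Hm m m' x0" and x: "x \<in> {-1..1}" "x \<noteq> x0"
  shows "m x < m x0"
proof -
  have m: "C1_on {-1..1} m m'" and x0: "-1 < x0" "x0 < 1" and max0: "is_max_point m x0"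
    and uniq: "\<And>y. y \<in> {-1<..<1} \<Longrightarrow> is_max_point m y \<Longrightarrow> y = x0"
    and inc: "\<And>x. x \<in> {-1..<x0} \<Longrightarrow> 0 \<le> m' x" and dec: "\<And>x. x \<in> {x0<..1} \<Longrightarrow> m' x \<le> 0"
    using Hm by (auto simp: cond_Hm_def)
  have dm: "(m has_real_derivative m' x) (at x within {-1..1})" if "x \<in> {-1..1}" for x
    using m that by (simp add: C1_on_def)
  have cm: "continuous_on {-1..1} m" using dm by (rule DERIV_continuous_on)
  have top: "m y \<le> m x0" if "y \<in> {-1..1}" for y
  proof -
    have "bdd_above (m ` {-1..1})"
      by (intro bounded_imp_bdd_above compact_imp_bounded compact_continuous_image cm compact_Icc)
    then have "m y \<le> (SUP y\<in>{-1..1}. m y)" using that by (intro cSUP_upper)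
    moreover have "m x0 = (SUP y\<in>{-1..1}. m y)" using max0 unfolding is_max_point_def by blast
    ultimately show ?thesis by linarith
  qed
  define y where "y = (x + x0) / 2"
  have y: "y \<in> {-1<..<1}" "y \<noteq> x0" using x x0 by (auto simp: y_def field_simps)
  have "m x \<le> m y"
  proof (cases "x < x0")
    case True
    then have xy: "x < y" "y < x0" by (auto simp: y_def)
    show ?thesis
    proof (rule nondecreasing_if_derivative_nonneg[of x y m m' x y])
      show "(m has_real_derivative m' t) (at t within {x..y})" "0 \<le> m' t" if "t \<in> {x..y}" for t
        using that xy x x0 by (auto intro!: inc DERIV_subset[OF dm])
    qed (use xy in auto)
  next
    case False
    then have xy: "x0 < y" "y < x" using x by (auto simp: y_def)
    have "- m y \<le> - m x"
    proof (rule nondecreasing_if_derivative_nonneg[of y x "\<lambda>x. - m x" "\<lambda>x. - m' x" y x])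
      show "((\<lambda>x. - m x) has_real_derivative - m' t) (at t within {y..x})" "0 \<le> - m' t"
        if "t \<in> {y..x}" for t
        using that xy x x0 by (auto intro!: dec DERIV_minus DERIV_subset[OF dm])
    qed (use xy in auto)
    then show ?thesis by simp
  qed
  moreover have "m y \<noteq> m x0"
    using uniq[OF y(1)] y(2) max0 by (auto simp: is_max_point_def)
  ultimately show ?thesis using top[of y] y(1) by fastforce
qed

text \<open>
  The function \<open>exp (2 s m) f' / f\<close> vanishes at both ends, and its derivative is
  \<open>exp (2 s m) (c - l)\<close> minus a square.
\<close>

lemma eigenvalue_integral_inequality:
  assumes m: "C1_on {-1..1} m m'" and cc: "continuous_on {-1..1} c"
    and sol: "has_positive_neumann_solution m' c s l"
  shows "0 \<le> integral {-1..1} (\<lambda>x. exp (2 * s * m x) * (c x - l))"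
proof -
  obtain f f' f'' where f: "C1_on {-1..1} f f'" "C1_on {-1..1} f' f''" "\<And>x. x \<in> {-1..1} \<Longrightarrow> f x > 0"
     "\<And>x. x \<in> {-1..1} \<Longrightarrow> - f'' x - 2 * s * m' x * f' x + c x * f x = l * f x" "f' (-1) = 0" "f' 1 = 0"
    using sol unfolding has_positive_neumann_solution_def by blast
  have dm: "(m has_real_derivative m' x) (at x within {-1..1})" if "x \<in> {-1..1}" for x
    using m that by (simp add: C1_on_def)
  have cm: "continuous_on {-1..1} m" using dm by (rule DERIV_continuous_on)
  let ?Y = "\<lambda>x. exp (2 * s * m x) * f' x / f x"
  let ?Y' = "\<lambda>x. exp (2 * s * m x) * (c x - l) - exp (2 * s * m x) * (f' x / f x)\<^sup>2"
  have dY: "(?Y has_real_derivative ?Y' x) (at x within {-1..1})" if x: "x \<in> {-1..1}" for x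
  proof -
    have d: "(m has_real_derivative m' x) (at x within {-1..1})"
      "(f has_real_derivative f' x) (at x within {-1..1})" "(f' has_real_derivative f'' x) (at x within {-1..1})"
      using m f(1,2) x by (auto simp: C1_on_def)
    have f'': "f'' x = (c x - l) * f x - 2 * s * m' x * f' x"
      using f(4)[OF x] by (simp add: algebra_simps)
    show ?thesis
      by (rule derivative_eq_intros d refl)+
        (use f(3)[OF x] in \<open>simp_all add: f'' field_simps power2_eq_square\<close>)
  qed
  then have "(?Y' has_integral (?Y 1 - ?Y (-1))) {-1..1}"
    by (intro fundamental_theorem_of_calculus)
       (auto simp: has_real_derivative_iff_has_vector_derivative[symmetric])
  then have "(?Y' has_integral 0) {-1..1}" using f(5,6) by simp
  moreover have "((\<lambda>x. exp (2 * s * m x) * (c x - l)) has_integral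
      integral {-1..1} (\<lambda>x. exp (2 * s * m x) * (c x - l))) {-1..1}"
    by (intro integrable_integral integrable_continuous_real continuous_intros cm cc)
  ultimately show ?thesis
    by (rule has_integral_le) simp
qed

lemma principal_eigenvalue_upper_bound:
  assumes cc: "continuous_on {-1..1} c" and Hm: "cond_Hm m m' x0" and e: "0 < e"
  shows "\<forall>\<^sub>F s in at_top. \<forall>l. has_positive_neumann_solution m' c s l \<longrightarrow> l \<le> c x0 + e"
proof -
  have m: "C1_on {-1..1} m m'" and x0: "-1 < x0" "x0 < 1"
    using Hm by (auto simp: cond_Hm_def)
  have cm: "continuous_on {-1..1} m"
    using m unfolding C1_on_def by (auto intro: DERIV_continuous_on)
  have "\<forall>\<^sub>F s in at_top. integral {-1..1} (\<lambda>x. exp (s * (2 * m x)) * (c x - (c x0 + e))) < 0"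
  proof (rule laplace_concentration[of "-1" 1 "\<lambda>x. 2 * m x" "\<lambda>x. c x - (c x0 + e)" x0])
    show "2 * m x < 2 * m x0" if "x \<in> {-1..1}" "x \<noteq> x0" for x
      using cond_Hm_strict_maximum[OF Hm that] by simp
  qed (use x0 e in \<open>auto intro!: continuous_intros cm cc\<close>)
  then show ?thesis
  proof eventually_elim
    case (elim s)
    show ?case
    proof (intro allI impI, rule ccontr)
      fix l assume sol: "has_positive_neumann_solution m' c s l" and "\<not> l \<le> c x0 + e"
      then have "integral {-1..1} (\<lambda>x. exp (2 * s * m x) * (c x - l))
          \<le> integral {-1..1} (\<lambda>x. exp (2 * s * m x) * (c x - (c x0 + e)))"
        by (intro integral_le integrable_continuous_real continuous_intros cm cc) auto
      also have "\<dots> < 0" using elim by (simp add: mult_ac)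
      finally show False using eigenvalue_integral_inequality[OF m cc sol] by simp
    qed
  qed
qed

section \<open>The limit of the principal eigenvalue\<close>

theorem theorem1p2:
  fixes c m m' :: "real \<Rightarrow> real" and x0 :: real
  assumes "continuous_on {-1..1} c"
    and "cond_Hm m m' x0"
    and "(\<exists>y0\<in>{-1<..<1}. strict_mono_on {-1..<y0} c \<and> strict_antimono_on {y0<..1} c) \<or>
         (\<exists>y0\<in>{-1<..<1}. strict_antimono_on {-1..<y0} c \<and> strict_mono_on {y0<..1} c) \<or>
         strict_mono_on {-1..1} c \<or>
         strict_antimono_on {-1..1} c"
  shows "((\<lambda>s. principal_eigenvalue m' c s) \<longlongrightarrow> c x0) at_top"
proof (rule tendstoI)
  fix e :: real assume e: "0 < e"
  then have e2: "0 < e / 2" by simp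
  have m: "C1_on {-1..1} m m'" using assms(2) by (simp add: cond_Hm_def)
  have sol: "has_positive_neumann_solution m' c s (principal_eigenvalue m' c s)" for s
    by (rule has_positive_neumann_solution_principal_eigenvalue[OF m assms(1)])
  have "\<forall>\<^sub>F s in at_top. c x0 - e / 2 \<le> principal_eigenvalue m' c s"
  proof -
    obtain S where S: "\<And>s l. S \<le> s \<Longrightarrow> has_positive_neumann_solution m' c s l \<Longrightarrow> c x0 - e / 2 \<le> l"
      using principal_eigenvalue_lower_bound[OF assms(1,2) e2] by blast
    show ?thesis
      using eventually_ge_at_top[of S] by eventually_elim (rule S[OF _ sol])
  qed
  moreover have "\<forall>\<^sub>F s in at_top. principal_eigenvalue m' c s \<le> c x0 + e / 2"
    using principal_eigenvalue_upper_bound[OF assms(1,2) e2]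
    by eventually_elim (use sol in \<open>simp\<close>)
  ultimately show "\<forall>\<^sub>F s in at_top. dist (principal_eigenvalue m' c s) (c x0) < e"
    by eventually_elim (use e in \<open>auto simp: dist_real_def abs_less_iff\<close>)
qed

end
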